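(* For integers $2\le k\le n$, let $T_k(\textsc{OneMax}_n)$ denote the unbiased $k$-ary black-box complexity of $\textsc{OneMax}_n$. Then: (1) there is an absolute constant $C$ such that $T_k(\textsc{OneMax}_n)\le C n$ for all integers $n$ and $k$ with $2\le k\le n$; (2) moreover, there is a function $h:\{2,3,\ldots\}\to\mathbb{R}$, depending on $k$ only, with $\lim_{k\to\infty}h(k)=0$, such that $T_k(\textsc{OneMax}_n)\le (1+h(k))\,\dfrac{2n}{\log k}$ for all integers $n$ and $k$ with $2\le k\le n$.
   Context: $\log$ denotes the logarithm to base $2$, and $[n]=\{1,\ldots,n\}$. Unbiased operators. Let $n,k\in\mathbb{N}$ be positive integers. For $\sigma\in S_n$ (a permutation of $[n]$) and $x\in\{0,1\}^n$ write $\sigma(x):=x_{\sigma(1)}\cdots x_{\sigma(n)}$; $\oplus$ is bitwise exclusive-or. An unbiased $k$-ary variation operator on $\{0,1\}^n$ is a randomized operator which on input $(x^1,\ldots,x^k)\in(\{0,1\}^n)^k$ samples its output according to a conditional distribution $D(\cdot\mid x^1,\ldots,x^k)$ on $\{0,1\}^n$ such that for all $x^1,\ldots,x^k,y,z\in\{0,1\}^n$ and all $\sigma\in S_n$: (i) $D(y\mid x^1,\ldots,x^k)=D(y\oplus z\mid x^1\oplus z,\ldots,x^k\oplus z)$, and (ii) $D(y\mid x^1,\ldots,x^k)=D(\sigma(y)\mid\sigma(x^1),\ldots,\sigma(x^k))$. Unbiased $k$-ary black-box algorithms. Let $\mathcal{F}$ be a class of functions $f:\{0,1\}^n\to\mathbb{R}$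 to be maximized; $\mathcal F$ is known to the algorithm, but the particular $f\in\mathcal F$ is not. An unbiased $k$-ary black-box algorithm proceeds as follows: it samples $x^0$ uniformly at random from $\{0,1\}^n$ and queries $f(x^0)$; then for $t=1,2,3,\ldots$, depending only on $(f(x^0),\ldots,f(x^{t-1}))$ (and possibly its own internal randomness), it chooses an unbiased $k$-ary variation operator $p^t$ and $k$ previously queried search points $y^1,\ldots,y^k$ (any of $x^0,\ldots,x^{t-1}$, not necessarily distinct, specified by their indices), samples $x^t$ according to $p^t(y^1,\ldots,y^k)$, and queries $f(x^t)$. Complexity. For an algorithm $A$ and $f\in\mathcal{F}$, $T_{A,f}$ is the expected number of queries until a maximizer of $f$ is queried for the first time. The unbiased $k$-ary black-box complexity of $\mathcal{F}$ is $\min_A\max_{f\in\mathcal{F}}T_{A,f}$, where $A$ ranges over all unbiased $k$-ary black-box algorithms. OneMax. For $z\in\{0,1\}^n$ let $\textsc{Om}_z:\{0,1\}^n\to\mathbb{N}\cup\{0\}$, $\textsc{Om}_z(x)=|\{j\in[n]\mid x_j=z_j\}|$, and $\textsc{OneMax}_n:=\{\textsc{Om}_z\mid z\in\{0,1\}^n\}$. *)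

theory Defs
  imports "HOL-Probability.Probability" "HOL-Combinatorics.Permutations"
begin

section \<open>Unbiased variation operators on the hypercube\<close>

text \<open>
  Bit strings are Boolean lists whose positions are numbered from 0. In particular
  \<^term>\<open>permute_list \<sigma> x\<close> is the string whose \<open>i\<close>-th entry is the \<open>\<sigma> i\<close>-th entry of \<open>x\<close>.
\<close>

type_synonym bits = "bool list"

definition cube :: "nat \<Rightarrow> bits set" where
  "cube n = {x. length x = n}"

definition xor_bits :: "bits \<Rightarrow> bits \<Rightarrow> bits" (infixl "\<oplus>\<^sub>b" 65) where
  "x \<oplus>\<^sub>b y = map2 (\<noteq>) x y"

type_synonym variation = "bits list \<Rightarrow> bits pmf"

definition unbiased_variation :: "nat \<Rightarrow> nat \<Rightarrow> variation \<Rightarrow> bool" where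
  "unbiased_variation n k D \<longleftrightarrow>
     (\<forall>xs. length xs = k \<and> set xs \<subseteq> cube n \<longrightarrow>
        set_pmf (D xs) \<subseteq> cube n \<and>
        (\<forall>y\<in>cube n. \<forall>z\<in>cube n.
           pmf (D xs) y = pmf (D (map (\<lambda>x. x \<oplus>\<^sub>b z) xs)) (y \<oplus>\<^sub>b z)) \<and>
        (\<forall>y\<in>cube n. \<forall>\<sigma>. \<sigma> permutes {..<n} \<longrightarrow>
           pmf (D xs) y = pmf (D (map (permute_list \<sigma>) xs)) (permute_list \<sigma> y)))"


section \<open>Unbiased black-box algorithms\<close>

text \<open>
  One step of an algorithm is determined by an operator together with the list of the indices
  of the search points it is applied to.

  An algorithm maps the list of the choices it made so far and the list of all objective values
  seen so far to the distribution of its next choice. The search points themselves are not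
  visible to it. Recalling the earlier choices is what lets internal random decisions influence
  later steps: since the sampled points depend on the internal randomness only through the
  choices, any other internal memory could be resampled from its conditional distribution given
  the choices and objective values.
\<close>

type_synonym choice = "variation \<times> nat list"

type_synonym blackbox = "choice list \<Rightarrow> real list \<Rightarrow> choice pmf"

definition unbiased_blackbox :: "nat \<Rightarrow> nat \<Rightarrow> blackbox \<Rightarrow> bool" where
  "unbiased_blackbox n k A \<longleftrightarrow>
     (\<forall>cs vs. length vs = Suc (length cs) \<longrightarrow>
        (\<forall>(D, js) \<in> set_pmf (A cs vs).
           unbiased_variation n k D \<and> length js = k \<and> set js \<subseteq> {..<length vs}))"

text \<open>
  Joint distribution of the first \<open>t\<close> choices and the first \<open>t + 1\<close> search points
  \<open>x\<^sup>0, \<dots>, x\<^sup>t\<close>.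
\<close>

primrec run :: "nat \<Rightarrow> blackbox \<Rightarrow> (bits \<Rightarrow> real) \<Rightarrow> nat \<Rightarrow> (choice list \<times> bits list) pmf" where
  "run n A f 0 = map_pmf (\<lambda>x. ([], [x])) (pmf_of_set (cube n))"
| "run n A f (Suc t) =
     do {
       (cs, xs) \<leftarrow> run n A f t;
       (D, js) \<leftarrow> A cs (map f xs);
       x \<leftarrow> D (map (\<lambda>j. xs ! j) js);
       return_pmf (cs @ [(D, js)], xs @ [x])
     }"

abbreviation maximizer :: "nat \<Rightarrow> (bits \<Rightarrow> real) \<Rightarrow> bits \<Rightarrow> bool" where
  "maximizer n f x \<equiv> is_arg_max f (\<lambda>y. y \<in> cube n) x"

text \<open>The probability that \<open>x\<^sup>t\<close> is the first maximizer, i.e. that \<open>t + 1\<close> queries are needed.\<close>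

definition first_hit_prob :: "nat \<Rightarrow> blackbox \<Rightarrow> (bits \<Rightarrow> real) \<Rightarrow> nat \<Rightarrow> real" where
  "first_hit_prob n A f t =
     measure_pmf.prob (run n A f t)
       {(cs, xs). maximizer n f (xs ! t) \<and> (\<forall>s<t. \<not> maximizer n f (xs ! s))}"

text \<open>
  The number of queries is infinite if no maximizer is ever queried; the second summand is the
  contribution of that event to the expectation (with \<open>\<infinity> * 0 = 0\<close>).
\<close>

definition expected_queries :: "nat \<Rightarrow> blackbox \<Rightarrow> (bits \<Rightarrow> real) \<Rightarrow> ennreal" where
  "expected_queries n A f =
     (\<Sum>t. of_nat (t + 1) * ennreal (first_hit_prob n A f t))
     + \<infinity> * (1 - (\<Sum>t. ennreal (first_hit_prob n A f t)))"

definition unbiased_complexity :: "nat \<Rightarrow> nat \<Rightarrow> (bits \<Rightarrow> real) set \<Rightarrow> ennreal" where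
  "unbiased_complexity n k F =
     (INF A \<in> {A. unbiased_blackbox n k A}. SUP f \<in> F. expected_queries n A f)"


section \<open>OneMax\<close>

definition Om :: "nat \<Rightarrow> bits \<Rightarrow> bits \<Rightarrow> real" where
  "Om n z x = real (card {j \<in> {..<n}. x ! j = z ! j})"

definition OneMax :: "nat \<Rightarrow> (bits \<Rightarrow> real) set" where
  "OneMax n = Om n ` cube n"

end

theory Submission
  imports Defs "HOL-Real_Asymp.Real_Asymp"
begin

text \<open>
  Two inputs suffice for \<open>2 n + 2\<close> expected queries: maintain two strings whose sets of wrong
  positions are disjoint (initially a random string and its complement) and flip, in the worse
  one, a random position where they differ. At least half of these positions are wrong in the
  worse string, so each query repairs a position with probability at least \<open>1/2\<close>.

  For large \<open>k\<close>, split the positions into blocks of size \<open>r 2\<^sup>r / 2\<close> with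
  \<open>r = \<lfloor>log k - sqrt (log k)\<rfloor>\<close>. An unbiased operator can
  mark a fresh block by flipping it in the last string that still agrees with \<open>x\<^sup>0\<close> there. Inside
  a marked block it can produce, up to an unknown permutation of the block, the \<open>2\<^sup>r\<close> queries given
  by a detecting matrix of Cantor and Mills, and their values determine the wrong positions of the
  block uniquely. One more query repairs them. This takes \<open>2\<^sup>r + 2\<close> queries per block and
  never fails, hence about \<open>2 n / r\<close> queries in total.
\<close>

section \<open>Expected number of queries\<close>

lemma finite_cube [simp, intro]: "finite (cube n)"
  using finite_lists_length_eq[of "UNIV :: bool set" n] by (simp add: cube_def)

lemma cube_nonempty [simp]: "cube n \<noteq> {}"
proof -
  have "replicate n False \<in> cube n" by (simp add: cube_def)
  thus ?thesis by blast
qed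

definition tail_prob :: "nat \<Rightarrow> blackbox \<Rightarrow> (bits \<Rightarrow> real) \<Rightarrow> nat \<Rightarrow> real" where
  "tail_prob n A f t =
     measure_pmf.prob (run n A f t) {(cs, xs). \<forall>s\<le>t. \<not> maximizer n f (xs ! s)}"

lemma prob_cong_set_pmf:
  assumes "\<And>h. h \<in> set_pmf M \<Longrightarrow> h \<in> X \<longleftrightarrow> h \<in> Y"
  shows "measure_pmf.prob M X = measure_pmf.prob M Y"
proof -
  have "X \<inter> set_pmf M = Y \<inter> set_pmf M" using assms by blast
  thus ?thesis by (metis measure_Int_set_pmf)
qed

lemma length_run: "(cs, xs) \<in> set_pmf (run n A f t) \<Longrightarrow> length xs = Suc t"
  by (induction t arbitrary: cs xs) (auto split: prod.splits)

text \<open>A step only appends a point, so forgetting it recovers the earlier distribution. This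
  lets events about the first \<open>t + 1\<close> points be evaluated in the run of length
  \<open>t + 1\<close>.\<close>

lemma map_butlast_run:
  "map_pmf (\<lambda>h. butlast (snd h)) (run n A f (Suc t)) = map_pmf snd (run n A f t)"
  by (simp add: map_bind_pmf case_prod_unfold) (simp add: map_pmf_def)

lemma prob_butlast_run:
  "measure_pmf.prob (run n A f (Suc t)) {h. butlast (snd h) \<in> X}
     = measure_pmf.prob (run n A f t) {h. snd h \<in> X}"
proof -
  have "measure_pmf.prob (map_pmf (\<lambda>h. butlast (snd h)) (run n A f (Suc t))) X
      = measure_pmf.prob (map_pmf snd (run n A f t)) X"
    by (simp only: map_butlast_run)
  thus ?thesis by (simp add: measure_map_pmf vimage_def del: run.simps)
qed

lemma first_hit_tail_0: "first_hit_prob n A f 0 + tail_prob n A f 0 = 1"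
proof -
  have "tail_prob n A f 0
      = measure_pmf.prob (run n A f 0) (UNIV - {(cs, xs). maximizer n f (xs ! 0) \<and> (\<forall>s<0. \<not> maximizer n f (xs ! s))})"
    unfolding tail_prob_def by (intro arg_cong[where f = "measure_pmf.prob _"]) auto
  thus ?thesis
    unfolding first_hit_prob_def by (subst (asm) measure_pmf.prob_compl[simplified]) auto
qed

text \<open>The event that the first \<open>t + 1\<close> points all miss is split according to
  whether the next point is a maximizer.\<close>

lemma first_hit_tail_Suc:
  "first_hit_prob n A f (Suc t) + tail_prob n A f (Suc t) = tail_prob n A f t"
proof -
  let ?M = "run n A f (Suc t)"
  let ?F = "{(cs, xs). maximizer n f (xs ! Suc t) \<and> (\<forall>s<Suc t. \<not> maximizer n f (xs ! s))}"
  let ?G = "{(cs, xs). \<forall>s\<le>Suc t. \<not> maximizer n f (xs ! s)}"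
  let ?X = "{xs. \<forall>s\<le>t. \<not> maximizer n f (xs ! s)}"
  have "measure_pmf.prob ?M ?F + measure_pmf.prob ?M ?G = measure_pmf.prob ?M (?F \<union> ?G)"
    by (subst measure_pmf.finite_measure_Union) auto
  also have "?F \<union> ?G = {h. \<forall>s\<le>t. \<not> maximizer n f (snd h ! s)}"
    by (auto simp: le_Suc_eq less_Suc_eq_le)
  also have "measure_pmf.prob ?M \<dots> = measure_pmf.prob ?M {h. butlast (snd h) \<in> ?X}"
    by (intro prob_cong_set_pmf)
       (auto simp: nth_butlast dest!: length_run simp del: run.simps)
  also have "\<dots> = measure_pmf.prob (run n A f t) {h. snd h \<in> ?X}"
    by (rule prob_butlast_run)
  finally show ?thesis
    by (simp add: first_hit_prob_def tail_prob_def case_prod_unfold del: run.simps)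
qed

text \<open>The usual tail formula for an expectation; the leading 1 accounts for the query of
  \<open>x^0\<close>. If the tails have infinite sum there is nothing to show. Otherwise they tend
  to 0, so a maximizer is found almost surely and the infinite summand of
  \<open>expected_queries\<close> vanishes.\<close>

lemma expected_queries_le_tail:
  "expected_queries n A f \<le> 1 + (\<Sum>t. ennreal (tail_prob n A f t))"
proof (cases "(\<Sum>t. ennreal (tail_prob n A f t)) = \<infinity>")
  case False
  define p where "p = first_hit_prob n A f"
  define q where "q = tail_prob n A f"
  have nonneg: "p t \<ge> 0" "q t \<ge> 0" for t
    by (auto simp: p_def q_def first_hit_prob_def tail_prob_def)
  have p0: "p 0 = 1 - q 0"
    using first_hit_tail_0[of n A f] by (simp add: p_def q_def)
  have pSuc: "p (Suc t) = q t - q (Suc t)" for t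
    using first_hit_tail_Suc[of n A f t] by (simp add: p_def q_def)
  have "(\<Sum>t. ennreal (q t)) \<noteq> top" using False by (simp add: q_def)
  hence "summable q"
    by (rule summable_suminf_not_top[OF nonneg(2)])
  hence q0: "q \<longlonglongrightarrow> 0" by (rule summable_LIMSEQ_zero)
  have psum: "(\<Sum>t\<le>T. p t) = 1 - q T" for T
    by (induction T) (simp_all add: p0 pSuc)
  have "p sums (1 - 0)"
    unfolding sums_def_le psum by (intro tendsto_intros q0)
  hence total: "(\<Sum>t. ennreal (p t)) = 1"
    using nonneg(1) by (subst suminf_ennreal2) (auto simp: sums_iff)
  \<comment> \<open>Summation by parts, with the boundary term kept so that the identity holds for
    every finite \<open>T\<close>.\<close>
  have weighted: "(\<Sum>t\<le>T. real (t + 1) * p t) + real (T + 1) * q T = 1 + (\<Sum>t<T. q t)" for T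
    by (induction T) (simp_all add: p0 pSuc algebra_simps)
  have "(\<Sum>t. of_nat (t + 1) * ennreal (p t)) \<le> 1 + (\<Sum>t. ennreal (q t))"
  proof (rule suminf_le_const)
    fix T
    have "(\<Sum>t<T. of_nat (t + 1) * ennreal (p t)) \<le> (\<Sum>t\<le>T. of_nat (t + 1) * ennreal (p t))"
      by (intro sum_mono2) auto
    also have "\<dots> = ennreal (\<Sum>t\<le>T. real (t + 1) * p t)"
      using nonneg by (subst sum_ennreal[symmetric]) (auto simp: ennreal_mult ennreal_of_nat_eq_real_of_nat)
    also have "\<dots> \<le> ennreal (1 + (\<Sum>t<T. q t))"
      using weighted[of T] nonneg(2)[of T] by (intro ennreal_leI) (smt (verit) mult_nonneg_nonneg of_nat_0_le_iff)
    also have "\<dots> = 1 + (\<Sum>t<T. ennreal (q t))"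
      using nonneg by (simp add: sum_nonneg)
    also have "\<dots> \<le> 1 + (\<Sum>t. ennreal (q t))"
      by (intro add_left_mono sum_le_suminf) auto
    finally show "(\<Sum>t<T. of_nat (t + 1) * ennreal (p t)) \<le> 1 + (\<Sum>t. ennreal (q t))" .
  qed auto
  thus ?thesis
    using total by (simp add: expected_queries_def p_def q_def)
qed auto

lemma expected_queries_bounded_time:
  assumes "\<And>cs xs. (cs, xs) \<in> set_pmf (run n A f N) \<Longrightarrow> \<exists>s\<le>N. maximizer n f (xs ! s)"
  shows "expected_queries n A f \<le> of_nat (N + 1)"
proof -
  have le1: "tail_prob n A f t \<le> 1" for t
    by (simp add: tail_prob_def)
  have zero: "tail_prob n A f t = 0" if "t \<ge> N" for t
    using that
  proof (induction rule: dec_induct)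
    case base
    show ?case unfolding tail_prob_def using assms by (fastforce simp: measure_pmf_zero_iff)
  next
    case (step t)
    have "tail_prob n A f (Suc t) \<ge> 0" "first_hit_prob n A f (Suc t) \<ge> 0"
      by (simp_all add: tail_prob_def first_hit_prob_def)
    thus ?case using first_hit_tail_Suc[of n A f t] step.IH by linarith
  qed
  have "(\<Sum>t. ennreal (tail_prob n A f t)) = (\<Sum>t<N. ennreal (tail_prob n A f t))"
    using zero by (intro suminf_finite) auto
  also have "\<dots> \<le> (\<Sum>t<N. 1)"
    using le1 by (intro sum_mono) simp
  finally have "1 + (\<Sum>t. ennreal (tail_prob n A f t)) \<le> 1 + of_nat N"
    by (intro add_left_mono) simp
  hence "expected_queries n A f \<le> 1 + of_nat N"
    using expected_queries_le_tail[of n A f] by (rule order_trans[rotated])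
  thus ?thesis by (simp add: add.commute)
qed

section \<open>Strategies determined by objective values, and additive drift\<close>

definition value_based :: "(real list \<Rightarrow> choice) \<Rightarrow> blackbox" where
  "value_based S = (\<lambda>_ vs. return_pmf (S vs))"

definition next_point :: "(real list \<Rightarrow> choice) \<Rightarrow> (bits \<Rightarrow> real) \<Rightarrow> bits list \<Rightarrow> bits pmf" where
  "next_point S f xs = (case S (map f xs) of (D, js) \<Rightarrow> D (map ((!) xs) js))"

lemma run_value_based_Suc:
  "run n (value_based S) f (Suc t) =
     run n (value_based S) f t \<bind>
       (\<lambda>(cs, xs). map_pmf (\<lambda>x. (cs @ [S (map f xs)], xs @ [x])) (next_point S f xs))"
  by (auto simp: value_based_def next_point_def map_pmf_def bind_return_pmf case_prod_unfold
           intro!: bind_pmf_cong)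

text \<open>Additive drift: while no maximizer has been queried, the potential falls by at least 1
  per step in expectation. With \<open>E t\<close> the expected potential restricted to such runs,
  this gives \<open>E (Suc t) + q t \<le> E t\<close>, and telescoping bounds the sum of the tails
  by \<open>E 0\<close>. The potential takes values in \<open>ennreal\<close>, so no integrability
  arises.\<close>

lemma expected_queries_drift:
  fixes \<Phi> :: "bits list \<Rightarrow> ennreal"
  assumes drift: "\<And>t cs xs. (cs, xs) \<in> set_pmf (run n (value_based S) f t) \<Longrightarrow>
      (\<forall>x\<in>set xs. \<not> maximizer n f x) \<Longrightarrow>
      1 + (\<integral>\<^sup>+x. \<Phi> (xs @ [x]) \<partial>next_point S f xs) \<le> \<Phi> xs"
    and init: "\<And>x. x \<in> cube n \<Longrightarrow> \<Phi> [x] \<le> B"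
  shows "expected_queries n (value_based S) f \<le> 1 + B"
proof -
  let ?R = "run n (value_based S) f"
  define miss where "miss xs \<longleftrightarrow> (\<forall>x\<in>set xs. \<not> maximizer n f x)" for xs
  define E where "E t = (\<integral>\<^sup>+h. \<Phi> (snd h) * indicator {h. miss (snd h)} h \<partial>?R t)" for t
  define q where "q t = ennreal (tail_prob n (value_based S) f t)" for t
  have q: "q t = (\<integral>\<^sup>+h. indicator {h. miss (snd h)} h \<partial>?R t)" for t
  proof -
    have "tail_prob n (value_based S) f t = measure_pmf.prob (?R t) {h. miss (snd h)}"
      unfolding tail_prob_def
      by (intro prob_cong_set_pmf)
         (auto simp: miss_def all_set_conv_all_nth less_Suc_eq_le dest!: length_run)
    thus ?thesis by (simp add: q_def measure_pmf.emeasure_eq_measure)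
  qed
  have step: "E (Suc t) + q t \<le> E t" for t
  proof -
    \<comment> \<open>A history that already contains a maximizer keeps it, so both sides vanish;
      otherwise the indicator on the left is bounded by 1.\<close>
    have "(\<integral>\<^sup>+x. \<Phi> (xs @ [x]) * indicator {h. miss (snd h)} (cs, xs @ [x]) \<partial>next_point S f xs)
        \<le> (\<integral>\<^sup>+x. \<Phi> (xs @ [x]) \<partial>next_point S f xs) * indicator {h. miss (snd h)} (cs, xs)" for cs xs
    proof (cases "miss xs")
      case True
      thus ?thesis by (auto simp: indicator_def intro!: nn_integral_mono)
    next
      case False
      hence "\<not> miss (xs @ [x])" for x by (auto simp: miss_def)
      thus ?thesis by simp
    qed
    hence "E (Suc t) \<le> (\<integral>\<^sup>+h. (\<integral>\<^sup>+x. \<Phi> (snd h @ [x]) \<partial>next_point S f (snd h)) * indicator {h. miss (snd h)} h \<partial>?R t)"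
      unfolding E_def run_value_based_Suc
      by (auto simp: case_prod_unfold indicator_def intro!: nn_integral_mono)
    hence "E (Suc t) + q t \<le>
        (\<integral>\<^sup>+h. (1 + (\<integral>\<^sup>+x. \<Phi> (snd h @ [x]) \<partial>next_point S f (snd h))) * indicator {h. miss (snd h)} h \<partial>?R t)"
      unfolding q by (simp add: distrib_right nn_integral_add add.commute add_left_mono)
    also have "\<dots> \<le> E t"
      unfolding E_def using drift
      by (intro nn_integral_mono_AE) (auto simp: AE_measure_pmf_iff indicator_def miss_def)
    finally show ?thesis .
  qed
  have sum: "(\<Sum>t<T. q t) + E T \<le> E 0" for T
  proof (induction T)
    case (Suc T)
    have "(\<Sum>t<Suc T. q t) + E (Suc T) = (\<Sum>t<T. q t) + (E (Suc T) + q T)"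
      by (simp add: add_ac)
    also have "\<dots> \<le> (\<Sum>t<T. q t) + E T" by (intro add_left_mono step)
    finally show ?case using Suc.IH by (rule order_trans)
  qed simp
  have "E 0 \<le> (\<integral>\<^sup>+h. B \<partial>?R 0)"
    unfolding E_def using init
    by (intro nn_integral_mono_AE) (auto simp: AE_measure_pmf_iff indicator_def)
  hence E0: "E 0 \<le> B" by simp
  have "1 + (\<Sum>t. q t) \<le> 1 + B"
  proof (rule add_left_mono)
    show "(\<Sum>t. q t) \<le> B"
    proof (rule suminf_le_const)
      show "(\<Sum>t<T. q t) \<le> B" for T
      proof -
        have "(\<Sum>t<T. q t) \<le> (\<Sum>t<T. q t) + E T" by simp
        also note sum
        also note E0
        finally show ?thesis .
      qed
    qed auto
  qed
  with expected_queries_le_tail[of n "value_based S" f] show ?thesis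
    unfolding q_def by (rule order_trans)
qed

section \<open>Disagreement sets and unbiased operators\<close>

definition disagree :: "nat \<Rightarrow> bits \<Rightarrow> bits \<Rightarrow> nat set" where
  "disagree n x y = {j\<in>{..<n}. x ! j \<noteq> y ! j}"

definition flip :: "nat \<Rightarrow> bits \<Rightarrow> nat set \<Rightarrow> bits" where
  "flip n x S = map (\<lambda>j. (x ! j) \<noteq> (j \<in> S)) [0..<n]"

lemma finite_disagree [simp, intro]: "finite (disagree n x y)"
  by (simp add: disagree_def)

lemma disagree_subset: "disagree n x y \<subseteq> {..<n}"
  by (auto simp: disagree_def)

lemma disagree_commute: "disagree n x y = disagree n y x"
  by (auto simp: disagree_def)

lemma disagree_self [simp]: "disagree n x x = {}"
  by (simp add: disagree_def)

lemma disagree_eq_empty_iff: "x \<in> cube n \<Longrightarrow> y \<in> cube n \<Longrightarrow> disagree n x y = {} \<longleftrightarrow> x = y"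
  by (auto simp: disagree_def cube_def list_eq_iff_nth_eq)

lemma flip_in_cube [simp, intro]: "flip n x S \<in> cube n"
  by (simp add: flip_def cube_def)

lemma disagree_flip_left: "disagree n (flip n x S) y = {j\<in>{..<n}. (j \<in> disagree n x y) \<noteq> (j \<in> S)}"
  by (auto simp: disagree_def flip_def)

lemma disagree_flip: "S \<subseteq> {..<n} \<Longrightarrow> disagree n x (flip n x S) = S"
  by (auto simp: disagree_def flip_def)

lemma Om_eq_disagree: "Om n z x = real n - real (card (disagree n z x))"
proof -
  have "{j \<in> {..<n}. x ! j = z ! j} = {..<n} - disagree n z x"
    by (auto simp: disagree_def)
  moreover have "card ({..<n} - disagree n z x) = n - card (disagree n z x)"
    using card_Diff_subset[of "disagree n z x" "{..<n}"] disagree_subset by auto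
  moreover have "card (disagree n z x) \<le> n"
    using card_mono[OF _ disagree_subset] by fastforce
  ultimately show ?thesis by (simp add: Om_def of_nat_diff)
qed

lemma maximizer_Om_iff:
  assumes "x \<in> cube n" "z \<in> cube n"
  shows "maximizer n (Om n z) x \<longleftrightarrow> x = z"
proof -
  have "Om n z y < Om n z z" if "y \<in> cube n" "y \<noteq> z" for y
    using that assms(2) disagree_eq_empty_iff[of z n y] by (auto simp: Om_eq_disagree card_gt_0_iff)
  moreover have "Om n z y \<le> Om n z z" for y by (simp add: Om_eq_disagree)
  ultimately show ?thesis
    using assms by (auto simp: is_arg_max_def not_less) (meson not_less)
qed

text \<open>In passing from \<open>a\<close> to \<open>y\<close>, each changed position lowers the
  distance to \<open>w\<close> by 1 if \<open>a\<close> was wrong there and raises it by 1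
  otherwise. Differences of OneMax values thus become linear in the indicator of the wrong
  positions.\<close>

lemma card_disagree_diff:
  "int (card (disagree n w a)) - int (card (disagree n w y))
     = (\<Sum>j\<in>disagree n a y. 2 * (if j \<in> disagree n w a then 1 else 0) - 1)"
proof -
  have card: "int (card (disagree n u v)) = (\<Sum>j<n. if j \<in> disagree n u v then 1 else 0)" for u v
  proof -
    have "{..<n} \<inter> {j. j \<in> disagree n u v} = disagree n u v"
      using disagree_subset by auto
    thus ?thesis by (simp add: sum.If_cases)
  qed
  have "int (card (disagree n w a)) - int (card (disagree n w y))
      = (\<Sum>j<n. if j \<in> disagree n a y then 2 * (if j \<in> disagree n w a then 1 else 0) - 1 else 0)"
    unfolding card sum_subtractf[symmetric] by (intro sum.cong) (auto simp: disagree_def)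
  also have "\<dots> = (\<Sum>j\<in>disagree n a y. 2 * (if j \<in> disagree n w a then 1 else 0) - 1)"
    using disagree_subset[of n a y]
    by (subst sum.inter_restrict[symmetric]) (auto intro!: sum.cong)
  finally show ?thesis .
qed

text \<open>The fallback to the whole cube makes the operator total: unbiasedness is required on all
  inputs, also on those where no \<open>y\<close> satisfies \<open>P\<close>.\<close>

definition uniform_op :: "nat \<Rightarrow> (bits list \<Rightarrow> bits \<Rightarrow> bool) \<Rightarrow> variation" where
  "uniform_op n P xs =
     pmf_of_set (if \<exists>y\<in>cube n. P xs y then {y\<in>cube n. P xs y} else cube n)"

text \<open>Shifts by xor (with \<open>\<tau>\<close> the identity) and coordinate permutations both
  move disagreement sets by a permutation \<open>\<tau>\<close>, so one condition covers both
  unbiasedness axioms. One implication is enough, since the converse follows from the inverse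
  map.\<close>

definition diff_invariant :: "nat \<Rightarrow> nat \<Rightarrow> (bits list \<Rightarrow> bits \<Rightarrow> bool) \<Rightarrow> bool" where
  "diff_invariant n k P \<longleftrightarrow>
     (\<forall>\<tau> g xs y. \<tau> permutes {..<n} \<longrightarrow> g ` cube n \<subseteq> cube n \<longrightarrow>
        (\<forall>x\<in>cube n. \<forall>y\<in>cube n. disagree n (g x) (g y) = \<tau> ` disagree n x y) \<longrightarrow>
        length xs = k \<longrightarrow> set xs \<subseteq> cube n \<longrightarrow> y \<in> cube n \<longrightarrow> P xs y \<longrightarrow> P (map g xs) (g y))"

lemma set_pmf_uniform_op:
  "set_pmf (uniform_op n P xs) = (if \<exists>y\<in>cube n. P xs y then {y\<in>cube n. P xs y} else cube n)"
  unfolding uniform_op_def by (subst set_pmf_of_set) auto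

text \<open>The bijection \<open>g\<close> carries the support for \<open>xs\<close> onto the
  support for \<open>map g xs\<close>, so the two uniform weights coincide.\<close>

lemma pmf_uniform_op_map:
  assumes g: "bij_betw g (cube n) (cube n)"
    and P: "\<And>y. y \<in> cube n \<Longrightarrow> P (map g xs) (g y) \<longleftrightarrow> P xs y" and y: "y \<in> cube n"
  shows "pmf (uniform_op n P xs) y = pmf (uniform_op n P (map g xs)) (g y)"
proof -
  define A where "A xs = (if \<exists>y\<in>cube n. P xs y then {y\<in>cube n. P xs y} else cube n)" for xs
  have inj: "inj_on g (cube n)" and img: "g ` cube n = cube n"
    using g by (auto simp: bij_betw_def)
  have sub: "A xs \<subseteq> cube n" and A: "finite (A xs)" "A xs \<noteq> {}" for xs
    by (auto simp: A_def)
  have "(\<exists>y\<in>g ` cube n. P (map g xs) y) \<longleftrightarrow> (\<exists>y\<in>cube n. P xs y)"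
    using P by auto
  moreover have "{y\<in>g ` cube n. P (map g xs) y} = g ` {y\<in>cube n. P xs y}"
    using P by auto
  ultimately have Ag: "A (map g xs) = g ` A xs"
    unfolding A_def img by (auto simp: img)
  have "card (g ` A xs) = card (A xs)"
    using inj sub by (meson card_image inj_on_subset)
  moreover have "g y \<in> g ` A xs \<longleftrightarrow> y \<in> A xs"
    using inj_on_image_mem_iff[OF inj y sub] .
  ultimately have "pmf (pmf_of_set (A xs)) y = pmf (pmf_of_set (A (map g xs))) (g y)"
    using A[of xs] unfolding Ag by (simp add: indicator_def)
  thus ?thesis by (simp add: uniform_op_def A_def)
qed

lemma diff_invariant_iff:
  assumes P: "diff_invariant n k P"
    and g: "\<tau> permutes {..<n}" "g ` cube n \<subseteq> cube n" "\<And>x. x \<in> cube n \<Longrightarrow> g' (g x) = x"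
      "\<And>x y. x \<in> cube n \<Longrightarrow> y \<in> cube n \<Longrightarrow> disagree n (g x) (g y) = \<tau> ` disagree n x y"
    and g': "\<tau>' permutes {..<n}" "g' ` cube n \<subseteq> cube n"
      "\<And>x y. x \<in> cube n \<Longrightarrow> y \<in> cube n \<Longrightarrow> disagree n (g' x) (g' y) = \<tau>' ` disagree n x y"
    and xs: "length xs = k" "set xs \<subseteq> cube n" and y: "y \<in> cube n"
  shows "P (map g xs) (g y) \<longleftrightarrow> P xs y"
proof
  assume "P xs y"
  thus "P (map g xs) (g y)"
    using P g(1,2,4) xs y unfolding diff_invariant_def by blast
next
  assume *: "P (map g xs) (g y)"
  have mem: "g y \<in> cube n" "set (map g xs) \<subseteq> cube n" "length (map g xs) = k"
    using xs y g(2) by auto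
  have "P (map g' (map g xs)) (g' (g y))"
    using P g' mem * unfolding diff_invariant_def by blast
  moreover have "map g' (map g xs) = xs"
    using g(3) xs(2) by (auto simp: subset_iff intro!: map_idI)
  ultimately show "P xs y" using g(3)[OF y] by simp
qed

lemma xor_bits_in_cube: "x \<in> cube n \<Longrightarrow> z \<in> cube n \<Longrightarrow> x \<oplus>\<^sub>b z \<in> cube n"
  by (simp add: cube_def xor_bits_def)

lemma xor_bits_cancel: "x \<in> cube n \<Longrightarrow> z \<in> cube n \<Longrightarrow> (x \<oplus>\<^sub>b z) \<oplus>\<^sub>b z = x"
  by (auto simp: cube_def xor_bits_def list_eq_iff_nth_eq)

lemma disagree_xor_bits:
  "x \<in> cube n \<Longrightarrow> y \<in> cube n \<Longrightarrow> z \<in> cube n \<Longrightarrow> disagree n (x \<oplus>\<^sub>b z) (y \<oplus>\<^sub>b z) = disagree n x y"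
  by (auto simp: cube_def xor_bits_def disagree_def)

lemma permute_list_in_cube: "x \<in> cube n \<Longrightarrow> permute_list \<sigma> x \<in> cube n"
  by (simp add: cube_def)

lemma permute_list_cancel:
  assumes "\<sigma> permutes {..<n}" "x \<in> cube n"
  shows "permute_list (inv \<sigma>) (permute_list \<sigma> x) = x"
  using assms permute_list_compose[of "inv \<sigma>" x \<sigma>] permutes_inv[of \<sigma> "{..<n}"]
  by (simp add: cube_def permutes_inv_o)

lemma disagree_permute_list:
  assumes \<sigma>: "\<sigma> permutes {..<n}" and x: "x \<in> cube n" "y \<in> cube n"
  shows "disagree n (permute_list \<sigma> x) (permute_list \<sigma> y) = inv \<sigma> ` disagree n x y"
proof -
  \<comment> \<open>Position \<open>j\<close> of a permuted string reads position
    \<open>\<sigma> j\<close>, so disagreement sets are pulled back along \<open>\<sigma>\<close>;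
    this is where the inverse comes from.\<close>
  have "disagree n (permute_list \<sigma> x) (permute_list \<sigma> y) = {j\<in>{..<n}. \<sigma> j \<in> disagree n x y}"
  proof -
    have "permute_list \<sigma> u ! j = u ! \<sigma> j" if "u \<in> cube n" "j < n" for u j
      using that \<sigma> by (intro permute_list_nth) (auto simp: cube_def)
    moreover have "\<sigma> j < n" if "j < n" for j
      using permutes_in_image[OF \<sigma>, of j] that by simp
    ultimately show ?thesis using x unfolding disagree_def by auto
  qed
  also have "\<dots> = inv \<sigma> ` disagree n x y"
  proof (intro equalityI subsetI)
    fix j assume "j \<in> {j\<in>{..<n}. \<sigma> j \<in> disagree n x y}"
    thus "j \<in> inv \<sigma> ` disagree n x y"
      using permutes_inverses(2)[OF \<sigma>, of j] by (metis (no_types, lifting) image_eqI mem_Collect_eq)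
  next
    fix j assume "j \<in> inv \<sigma> ` disagree n x y"
    then obtain i where "i \<in> disagree n x y" "j = inv \<sigma> i" by blast
    thus "j \<in> {j\<in>{..<n}. \<sigma> j \<in> disagree n x y}"
      using permutes_inverses(1)[OF \<sigma>, of i] permutes_in_image[OF permutes_inv[OF \<sigma>], of i]
        disagree_subset[of n x y] by auto
  qed
  finally show ?thesis .
qed

lemma bij_betw_cubeI:
  assumes "g ` cube n \<subseteq> cube n" "\<And>x. x \<in> cube n \<Longrightarrow> g' (g x) = x"
  shows "bij_betw g (cube n) (cube n)"
proof -
  have "inj_on g (cube n)" using assms(2) by (rule inj_on_inverseI)
  thus ?thesis
    using endo_inj_surj[OF finite_cube assms(1)] by (simp add: bij_betw_def)
qed

lemma unbiased_uniform_op: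
  assumes P: "diff_invariant n k P"
  shows "unbiased_variation n k (uniform_op n P)"
  unfolding unbiased_variation_def
proof (intro allI impI conjI ballI)
  fix xs assume xs: "length xs = k \<and> set xs \<subseteq> cube n"
  show "set_pmf (uniform_op n P xs) \<subseteq> cube n"
    by (auto simp: set_pmf_uniform_op)
  fix y assume y: "y \<in> cube n"
  show "pmf (uniform_op n P xs) y = pmf (uniform_op n P (map (\<lambda>x. x \<oplus>\<^sub>b z) xs)) (y \<oplus>\<^sub>b z)"
    if z: "z \<in> cube n" for z
  proof (rule pmf_uniform_op_map[OF _ _ y])
    show "bij_betw (\<lambda>x. x \<oplus>\<^sub>b z) (cube n) (cube n)"
      by (rule bij_betw_cubeI[of _ _ "\<lambda>x. x \<oplus>\<^sub>b z"]) (auto simp: z xor_bits_in_cube xor_bits_cancel)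
    show "P (map (\<lambda>x. x \<oplus>\<^sub>b z) xs) (y \<oplus>\<^sub>b z) \<longleftrightarrow> P xs y" if "y \<in> cube n" for y
      by (rule diff_invariant_iff[OF P, of id _ "\<lambda>x. x \<oplus>\<^sub>b z" id])
         (use xs z that in \<open>auto simp: xor_bits_in_cube xor_bits_cancel disagree_xor_bits permutes_id\<close>)
  qed
  show "pmf (uniform_op n P xs) y = pmf (uniform_op n P (map (permute_list \<sigma>) xs)) (permute_list \<sigma> y)"
    if \<sigma>: "\<sigma> permutes {..<n}" for \<sigma>
  proof (rule pmf_uniform_op_map[OF _ _ y])
    show "bij_betw (permute_list \<sigma>) (cube n) (cube n)"
      by (rule bij_betw_cubeI[of _ _ "permute_list (inv \<sigma>)"])
         (auto simp: permute_list_in_cube permute_list_cancel[OF \<sigma>])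
    show "P (map (permute_list \<sigma>) xs) (permute_list \<sigma> y) \<longleftrightarrow> P xs y" if "y \<in> cube n" for y
      by (rule diff_invariant_iff[OF P, of "inv \<sigma>" _ "permute_list (inv \<sigma>)" "inv (inv \<sigma>)"])
         (use xs that \<sigma> in \<open>auto simp: permute_list_in_cube permute_list_cancel permutes_inv disagree_permute_list\<close>)
  qed
qed

text \<open>
  Unused input slots, and slots whose search point does not exist yet, are filled with \<open>x\<^sup>0\<close>.
\<close>

definition pad_indices :: "nat \<Rightarrow> 'a list \<Rightarrow> nat list \<Rightarrow> nat list" where
  "pad_indices k vs js =
     map (\<lambda>i. if i < length js \<and> js ! i < length vs then js ! i else 0) [0..<k]"

lemma length_pad_indices [simp]: "length (pad_indices k vs js) = k"
  by (simp add: pad_indices_def)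

lemma set_pad_indices: "vs \<noteq> [] \<Longrightarrow> set (pad_indices k vs js) \<subseteq> {..<length vs}"
  by (auto simp: pad_indices_def)

definition uniform_strategy ::
    "nat \<Rightarrow> nat \<Rightarrow> (real list \<Rightarrow> bits list \<Rightarrow> bits \<Rightarrow> bool) \<Rightarrow> (real list \<Rightarrow> nat list) \<Rightarrow> real list \<Rightarrow> choice" where
  "uniform_strategy n k P J vs = (uniform_op n (P vs), pad_indices k vs (J vs))"

lemma unbiased_uniform_strategy:
  assumes "\<And>vs. diff_invariant n k (P vs)"
  shows "unbiased_blackbox n k (value_based (uniform_strategy n k P J))"
proof -
  have "set (pad_indices k vs (J vs)) \<subseteq> {..<length vs}"
    if "length vs = Suc m" for vs :: "real list" and m
    using that by (intro set_pad_indices) auto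
  moreover have "unbiased_variation n k (uniform_op n (P vs))" for vs
    using assms by (rule unbiased_uniform_op)
  ultimately show ?thesis
    by (simp add: unbiased_blackbox_def value_based_def uniform_strategy_def)
qed

section \<open>Runs of uniform strategies\<close>

definition op_inputs :: "nat \<Rightarrow> (real list \<Rightarrow> nat list) \<Rightarrow> (bits \<Rightarrow> real) \<Rightarrow> bits list \<Rightarrow> bits list" where
  "op_inputs k J f xs = map ((!) xs) (pad_indices k xs (J (map f xs)))"

lemma next_point_uniform_strategy:
  "next_point (uniform_strategy n k P J) f xs = uniform_op n (P (map f xs)) (op_inputs k J f xs)"
  by (simp add: next_point_def uniform_strategy_def op_inputs_def pad_indices_def)

lemma op_inputs_nth:
  assumes "i < k" "i < length (J (map f xs))" "J (map f xs) ! i < length xs"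
  shows "op_inputs k J f xs ! i = xs ! (J (map f xs) ! i)"
  using assms by (simp add: op_inputs_def pad_indices_def)

text \<open>A query satisfies its predicate whenever some string does, because the fallback is then
  not taken. Correctness proofs need only exhibit a witness \<open>y\<close>. The prefix
  \<open>take u xs\<close> is the history seen when point \<open>u\<close> is chosen.\<close>

lemma run_uniform_strategy:
  assumes "(cs, xs) \<in> set_pmf (run n (value_based (uniform_strategy n k P J)) f T)"
  shows "set xs \<subseteq> cube n"
    and "\<And>u y. 1 \<le> u \<Longrightarrow> u \<le> T \<Longrightarrow> y \<in> cube n \<Longrightarrow>
           P (map f (take u xs)) (op_inputs k J f (take u xs)) y \<Longrightarrow>
           P (map f (take u xs)) (op_inputs k J f (take u xs)) (xs ! u)"
proof -
  let ?I = "\<lambda>xs u. \<forall>y\<in>cube n. P (map f (take u xs)) (op_inputs k J f (take u xs)) y \<longrightarrow>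
      P (map f (take u xs)) (op_inputs k J f (take u xs)) (xs ! u)"
  have "set xs \<subseteq> cube n \<and> (\<forall>u\<in>{1..T}. ?I xs u)"
    using assms
  proof (induction T arbitrary: cs xs)
    case 0
    thus ?case by auto
  next
    case (Suc T)
    from Suc.prems obtain cs' xs' x where
      run: "(cs', xs') \<in> set_pmf (run n (value_based (uniform_strategy n k P J)) f T)"
      and x: "x \<in> set_pmf (uniform_op n (P (map f xs')) (op_inputs k J f xs'))"
      and xs: "xs = xs' @ [x]"
      unfolding run_value_based_Suc next_point_uniform_strategy by auto
    have len: "length xs' = Suc T" using run by (rule length_run)
    have IH: "set xs' \<subseteq> cube n" "\<forall>u\<in>{1..T}. ?I xs' u" using Suc.IH[OF run] by auto
    have "?I xs (Suc T)"
      using x len nth_append_length[of xs' x] unfolding xs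
      by (auto simp: set_pmf_uniform_op split: if_splits)
    moreover have "?I xs u" if "u \<in> {1..T}" for u
      using IH(2) that len unfolding xs by (simp add: nth_append)
    moreover have "x \<in> cube n" using x by (auto simp: set_pmf_uniform_op split: if_splits)
    moreover have "{1..Suc T} = insert (Suc T) {1..T}" by auto
    ultimately have "\<forall>u\<in>{1..Suc T}. ?I xs u" "x \<in> cube n" by simp_all
    thus ?case using IH(1) unfolding xs by simp
  qed
  thus "set xs \<subseteq> cube n"
    and "\<And>u y. 1 \<le> u \<Longrightarrow> u \<le> T \<Longrightarrow> y \<in> cube n \<Longrightarrow>
           P (map f (take u xs)) (op_inputs k J f (take u xs)) y \<Longrightarrow>
           P (map f (take u xs)) (op_inputs k J f (take u xs)) (xs ! u)"
    by auto
qed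

lemma unbiased_complexity_OneMax_le:
  assumes "unbiased_blackbox n k A" "\<And>z. z \<in> cube n \<Longrightarrow> expected_queries n A (Om n z) \<le> B"
  shows "unbiased_complexity n k (OneMax n) \<le> B"
proof -
  have "(SUP f\<in>OneMax n. expected_queries n A f) \<le> B"
    using assms(2) by (auto simp: OneMax_def intro!: SUP_least)
  thus ?thesis
    unfolding unbiased_complexity_def using assms(1) by (auto intro: INF_lower2)
qed

section \<open>A binary algorithm\<close>

text \<open>
  \<open>pair_at vs u\<close> holds the indices of the two current strings, the worse one first, after the
  queries \<open>0, \<dots>, u + 1\<close>.
\<close>

definition by_value :: "real list \<Rightarrow> nat \<times> nat \<Rightarrow> nat \<times> nat" where
  "by_value vs p = (if vs ! fst p \<le> vs ! snd p then p else prod.swap p)"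

primrec pair_at :: "real list \<Rightarrow> nat \<Rightarrow> nat \<times> nat" where
  "pair_at vs 0 = by_value vs (0, 1)"
| "pair_at vs (Suc u) =
     (let (a, b) = pair_at vs u in if vs ! a < vs ! (u + 2) then by_value vs (u + 2, b) else (a, b))"

definition pair_inputs :: "real list \<Rightarrow> nat list" where
  "pair_inputs vs =
     (if length vs < 2 then [] else let (a, b) = pair_at vs (length vs - 2) in [a, b])"

definition pair_step :: "nat \<Rightarrow> real list \<Rightarrow> bits list \<Rightarrow> bits \<Rightarrow> bool" where
  "pair_step n vs xs y \<longleftrightarrow>
     (if length vs < 2 then card (disagree n y (xs ! 0)) = n
      else card (disagree n y (xs ! 0)) = 1 \<and> disagree n y (xs ! 0) \<subseteq> disagree n (xs ! 0) (xs ! 1))"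

text \<open>The predicate speaks only of inclusions and cardinalities of disagreement sets, which an
  injective \<open>\<tau>\<close> preserves.\<close>

lemma diff_invariant_pair_step: "2 \<le> k \<Longrightarrow> diff_invariant n k (pair_step n vs)"
  unfolding diff_invariant_def
proof (intro allI impI)
  fix \<tau> g xs y
  assume k: "2 \<le> k" and \<tau>: "\<tau> permutes {..<n}"
    and g: "\<forall>x\<in>cube n. \<forall>y\<in>cube n. disagree n (g x) (g y) = \<tau> ` disagree n x y"
    and xs: "length xs = k" "set xs \<subseteq> cube n" "y \<in> cube n" and P: "pair_step n vs xs y"
  have mem: "xs ! 0 \<in> cube n" "xs ! 1 \<in> cube n" using xs k by (auto intro!: subsetD[OF xs(2)] nth_mem)
  have "inj \<tau>" using \<tau> by (rule permutes_inj)
  hence "card (\<tau> ` A) = card A" for A by (meson card_image inj_on_subset subset_UNIV)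
  thus "pair_step n vs (map g xs) (g y)"
    using P k g mem xs unfolding pair_step_def by (auto split: if_splits)
qed

lemma pair_at_less: "fst (pair_at vs u) < u + 2 \<and> snd (pair_at vs u) < u + 2"
  by (induction u) (auto simp: by_value_def Let_def case_prod_unfold split: if_splits)

text \<open>The pair after queries up to \<open>u + 1\<close> depends only on the values of these
  queries, so appending later ones does not alter it.\<close>

lemma pair_at_cong:
  "(\<And>i. i < u + 2 \<Longrightarrow> vs ! i = ws ! i) \<Longrightarrow> pair_at vs u = pair_at ws u"
proof (induction u)
  case (Suc u)
  have "pair_at vs u = pair_at ws u" using Suc by auto
  thus ?case
    using Suc.prems pair_at_less[of ws u] by (auto simp: by_value_def Let_def case_prod_unfold)
qed (auto simp: by_value_def)

lemma pair_at_append: "u + 2 \<le> length vs \<Longrightarrow> pair_at (vs @ ws) u = pair_at vs u"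
  by (rule pair_at_cong) (auto simp: nth_append)

section \<open>Analysis of the binary algorithm for a fixed target\<close>

context
  fixes n k :: nat and z :: bits
  assumes k: "2 \<le> k" and z: "z \<in> cube n"
begin

definition wrong :: "bits \<Rightarrow> nat set" where
  "wrong x = disagree n z x"

definition wrong_pair :: "bits list \<Rightarrow> nat set \<times> nat set" where
  "wrong_pair xs =
     (let (a, b) = pair_at (map (Om n z) xs) (length xs - 2) in (wrong (xs ! a), wrong (xs ! b)))"

definition pair_invariant :: "bits list \<Rightarrow> bool" where
  "pair_invariant xs \<longleftrightarrow>
     (let (A, B) = wrong_pair xs in A \<inter> B = {} \<and> card B \<le> card A)"

definition wrong_count :: "bits list \<Rightarrow> nat" where
  "wrong_count xs = (let (A, B) = wrong_pair xs in card A + card B)"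

lemma finite_wrong [simp, intro]: "finite (wrong x)"
  by (simp add: wrong_def)

lemma disagree_wrong: "disagree n x y = (wrong x - wrong y) \<union> (wrong y - wrong x)"
  by (auto simp: wrong_def disagree_def)

lemma Om_wrong: "Om n z x = real n - real (card (wrong x))"
  by (simp add: wrong_def Om_eq_disagree)

text \<open>Complementary strings have complementary sets of wrong positions.\<close>

lemma pair_init:
  assumes "card (disagree n y x) = n"
  shows "pair_invariant [x, y]" "wrong_count [x, y] = n"
proof -
  have all: "disagree n y x = {..<n}"
    using assms disagree_subset by (metis card_lessThan card_subset_eq finite_lessThan)
  have sub: "wrong x \<subseteq> {..<n}" "wrong y \<subseteq> {..<n}"
    unfolding wrong_def by (rule disagree_subset)+
  have disj: "wrong x \<inter> wrong y = {}" and un: "wrong x \<union> wrong y = {..<n}"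
    using all sub unfolding disagree_wrong[of y x] by auto
  have "card (wrong x) + card (wrong y) = n"
    using card_Un_disjoint[OF _ _ disj] un by simp
  thus "pair_invariant [x, y]" "wrong_count [x, y] = n"
    using disj by (auto simp: pair_invariant_def wrong_count_def wrong_pair_def by_value_def Om_wrong)
qed

text \<open>If \<open>j\<close> is wrong in the worse string, the flip repairs it and
  \<open>y\<close> takes its place, possibly as the new better string. Otherwise the flip damages
  the string and \<open>y\<close> is rejected. In either case no position becomes wrong in both
  strings of the pair.\<close>

lemma pair_step_update:
  assumes inv: "pair_invariant xs" and len: "length xs = u + 2"
    and ab: "pair_at (map (Om n z) xs) u = (a, b)"
    and y: "disagree n y (xs ! a) = {j}" "j \<in> disagree n (xs ! a) (xs ! b)"
  shows "pair_invariant (xs @ [y])"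
    and "wrong_count xs = wrong_count (xs @ [y]) + (if j \<in> wrong (xs ! a) then 1 else 0)"
proof -
  let ?f = "Om n z" and ?A = "wrong (xs ! a)" and ?B = "wrong (xs ! b)"
  have less: "a < u + 2" "b < u + 2" using pair_at_less[of "map ?f xs" u] ab by auto
  have disj: "?A \<inter> ?B = {}" and le: "card ?B \<le> card ?A" and count: "wrong_count xs = card ?A + card ?B"
    using inv len ab by (auto simp: pair_invariant_def wrong_count_def wrong_pair_def)
  have pair: "pair_at (map ?f (xs @ [y])) (Suc u)
      = (if ?f (xs ! a) < ?f y then by_value (map ?f (xs @ [y])) (u + 2, b) else (a, b))"
    using ab less len by (simp add: pair_at_append nth_append)
  have nth: "(xs @ [y]) ! a = xs ! a" "(xs @ [y]) ! b = xs ! b" "(xs @ [y]) ! (u + 2) = y"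
    using less len by (auto simp: nth_append)
  have len': "length (xs @ [y]) - 2 = Suc u" using len by simp
  have mem: "i \<in> wrong y \<longleftrightarrow> (i \<in> ?A) \<noteq> (i = j)" for i
    using y(1) unfolding disagree_wrong by (cases "i = j") blast+
  have "pair_invariant (xs @ [y]) \<and>
      wrong_count xs = wrong_count (xs @ [y]) + (if j \<in> wrong (xs ! a) then 1 else 0)"
  proof (cases "j \<in> ?A")
    case True
    have W: "wrong y = ?A - {j}" using mem True by auto
    have card: "card ?A = Suc (card (wrong y))"
      using True unfolding W by (simp only: card_Suc_Diff1 finite_wrong)
    have disj': "wrong y \<inter> ?B = {}" "?B \<inter> wrong y = {}" using disj W by auto
    have lens: "u + 2 < length (xs @ [y])" "b < length (xs @ [y])" using len less by auto
    have "wrong_pair (xs @ [y]) = (if card ?B \<le> card (wrong y) then (wrong y, ?B) else (?B, wrong y))"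
      unfolding wrong_pair_def len' pair using card lens
      by (simp add: by_value_def nth_map[OF lens(1)] nth_map[OF lens(2)] nth nth(3)[simplified] Om_wrong del: map_append append_assoc)
    thus ?thesis
      using disj' count card True by (auto simp: pair_invariant_def wrong_count_def)
  next
    case False
    have W: "wrong y = insert j ?A" using mem False by auto
    have "card (wrong y) = Suc (card ?A)" using False by (simp add: W)
    hence "wrong_pair (xs @ [y]) = (?A, ?B)"
      unfolding wrong_pair_def len' pair by (simp add: nth Om_wrong)
    thus ?thesis
      using disj le count False by (auto simp: pair_invariant_def wrong_count_def)
  qed
  thus "pair_invariant (xs @ [y])"
    and "wrong_count xs = wrong_count (xs @ [y]) + (if j \<in> wrong (xs ! a) then 1 else 0)"
    by auto
qed

text \<open>Admissible strings correspond bijectively to the flipped positions, so a uniform string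
  amounts to a uniform position.\<close>

lemma pair_next_point:
  assumes len: "length xs = u + 2" and cube: "set xs \<subseteq> cube n"
    and ab: "pair_at (map (Om n z) xs) u = (a, b)"
    and ne: "disagree n (xs ! a) (xs ! b) \<noteq> {}"
  shows "next_point (uniform_strategy n k (pair_step n) pair_inputs) (Om n z) xs
     = map_pmf (\<lambda>j. flip n (xs ! a) {j}) (pmf_of_set (disagree n (xs ! a) (xs ! b)))"
proof -
  let ?D = "disagree n (xs ! a) (xs ! b)" and ?in = "op_inputs k pair_inputs (Om n z) xs"
  have less: "a < u + 2" "b < u + 2" using pair_at_less[of "map (Om n z) xs" u] ab by auto
  have J: "pair_inputs (map (Om n z) xs) = [a, b]"
    using len ab by (simp add: pair_inputs_def)
  have "?in ! 0 = xs ! a" "?in ! 1 = xs ! b"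
    using k less len op_inputs_nth[of 0 k pair_inputs "Om n z" xs] op_inputs_nth[of 1 k pair_inputs "Om n z" xs]
    by (simp_all add: J)
  hence step: "pair_step n (map (Om n z) xs) ?in y
      \<longleftrightarrow> card (disagree n y (xs ! a)) = 1 \<and> disagree n y (xs ! a) \<subseteq> ?D" for y
    using len by (simp add: pair_step_def)
  have flip: "disagree n (flip n (xs ! a) {j}) (xs ! a) = {j}" if "j \<in> ?D" for j
    using that disagree_subset by (auto simp: disagree_flip_left)
  have Y: "{y\<in>cube n. pair_step n (map (Om n z) xs) ?in y} = (\<lambda>j. flip n (xs ! a) {j}) ` ?D"
  proof (intro equalityI subsetI)
    fix y assume "y \<in> {y\<in>cube n. pair_step n (map (Om n z) xs) ?in y}"
    hence y: "y \<in> cube n" "card (disagree n y (xs ! a)) = 1" "disagree n y (xs ! a) \<subseteq> ?D"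
      by (auto simp: step)
    then obtain j where j: "disagree n y (xs ! a) = {j}" by (auto simp: card_1_singleton_iff)
    hence "j \<in> ?D" using y by simp
    hence "disagree n (flip n (xs ! a) {j}) y = {}"
      using j unfolding disagree_flip_left disagree_commute[of n "xs ! a" y] by auto
    hence "y = flip n (xs ! a) {j}"
      using y(1) disagree_eq_empty_iff[of "flip n (xs ! a) {j}" n y] by simp
    thus "y \<in> (\<lambda>j. flip n (xs ! a) {j}) ` ?D" using \<open>j \<in> ?D\<close> by blast
  next
    fix y assume "y \<in> (\<lambda>j. flip n (xs ! a) {j}) ` ?D"
    thus "y \<in> {y\<in>cube n. pair_step n (map (Om n z) xs) ?in y}"
      using flip by (auto simp: step)
  qed
  have "inj_on (\<lambda>j. flip n (xs ! a) {j}) ?D"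
    using flip by (intro inj_onI) (metis singleton_inject)
  hence "pmf_of_set ((\<lambda>j. flip n (xs ! a) {j}) ` ?D)
      = map_pmf (\<lambda>j. flip n (xs ! a) {j}) (pmf_of_set ?D)"
    using ne by (simp add: map_pmf_of_set_inj)
  moreover have "\<exists>y\<in>cube n. pair_step n (map (Om n z) xs) ?in y"
    using Y ne by blast
  ultimately show ?thesis
    by (simp add: next_point_uniform_strategy uniform_op_def Y)
qed

lemma first_next_point:
  assumes "x \<in> cube n" "y \<in> set_pmf (next_point (uniform_strategy n k (pair_step n) pair_inputs) (Om n z) [x])"
  shows "card (disagree n y x) = n"
proof -
  have "op_inputs k pair_inputs (Om n z) [x] ! 0 = x"
    using k by (simp add: op_inputs_def pad_indices_def pair_inputs_def)
  hence step: "pair_step n (map (Om n z) [x]) (op_inputs k pair_inputs (Om n z) [x]) y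
      \<longleftrightarrow> card (disagree n y x) = n" for y
    by (simp add: pair_step_def)
  have "disagree n (flip n x {..<n}) x = {..<n}" by (auto simp: disagree_flip_left)
  hence "\<exists>y\<in>cube n. card (disagree n y x) = n" by (metis card_lessThan flip_in_cube)
  thus ?thesis
    using assms(2) unfolding next_point_uniform_strategy set_pmf_uniform_op step
    by (auto split: if_splits)
qed

text \<open>While \<open>z\<close> has not been queried, the worse string has a wrong position,
  which is correct in the other one. Hence the two strings differ and the fallback of
  \<open>uniform_op\<close> is never taken.\<close>

lemma pair_invariant_run:
  assumes "(cs, xs) \<in> set_pmf (run n (value_based (uniform_strategy n k (pair_step n) pair_inputs)) (Om n z) t)"
    and "z \<notin> set xs" "1 \<le> t"
  shows "pair_invariant xs"
  using assms
proof (induction t arbitrary: cs xs)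
  case (Suc t)
  let ?S = "uniform_strategy n k (pair_step n) pair_inputs"
  from Suc.prems(1) obtain cs' xs' y where
    run: "(cs', xs') \<in> set_pmf (run n (value_based ?S) (Om n z) t)"
    and y: "y \<in> set_pmf (next_point ?S (Om n z) xs')" and xs: "xs = xs' @ [y]"
    unfolding run_value_based_Suc by auto
  have len: "length xs' = Suc t" using run by (rule length_run)
  have cube: "set xs' \<subseteq> cube n" using run by (rule run_uniform_strategy(1))
  show ?case
  proof (cases t)
    case 0
    then obtain x where x: "xs' = [x]" using len by (auto simp: length_Suc_conv)
    thus ?thesis using first_next_point[of x y] pair_init(1)[of y x] y cube xs by simp
  next
    case (Suc u)
    have inv: "pair_invariant xs'" using Suc.IH[OF run] Suc.prems(2) Suc xs by auto
    have len': "length xs' = u + 2" using len Suc by simp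
    obtain a b where ab: "pair_at (map (Om n z) xs') u = (a, b)" by fastforce
    have "a < length xs'" using pair_at_less[of "map (Om n z) xs'" u] ab len' by auto
    hence "xs' ! a \<noteq> z" "xs' ! a \<in> cube n" using Suc.prems(2) xs cube by auto
    hence "wrong (xs' ! a) \<noteq> {}"
      using z disagree_eq_empty_iff[of z n "xs' ! a"] unfolding wrong_def by auto
    moreover have "wrong (xs' ! a) \<inter> wrong (xs' ! b) = {}"
      using inv ab len' by (auto simp: pair_invariant_def wrong_pair_def)
    ultimately have ne: "disagree n (xs' ! a) (xs' ! b) \<noteq> {}"
      unfolding disagree_wrong by auto
    have "y \<in> (\<lambda>j. flip n (xs' ! a) {j}) ` disagree n (xs' ! a) (xs' ! b)"
      using y ne unfolding pair_next_point[OF len' cube ab ne] by simp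
    then obtain j where j: "j \<in> disagree n (xs' ! a) (xs' ! b)" "y = flip n (xs' ! a) {j}" by blast
    hence "disagree n y (xs' ! a) = {j}"
      using disagree_subset[of n "xs' ! a" "xs' ! b"] by (auto simp: disagree_flip_left)
    thus ?thesis unfolding xs using pair_step_update(1)[OF inv len' ab _ j(1)] by blast
  qed
qed simp

lemma expected_queries_pair:
  "expected_queries n (value_based (uniform_strategy n k (pair_step n) pair_inputs)) (Om n z)
     \<le> ennreal (2 * real n + 2)"
proof -
  let ?S = "uniform_strategy n k (pair_step n) pair_inputs" and ?f = "Om n z"
  \<comment> \<open>Each wrong position costs two expected queries, since a flip succeeds with
    probability at least 1/2. The extra 1 at length 1 pays for the complement, after which the count
    is exactly \<open>n\<close>.\<close>
  define \<Phi> where "\<Phi> xs = ennreal (if length xs < 2 then 1 + 2 * real n else 2 * real (wrong_count xs))"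
    for xs :: "bits list"
  have "expected_queries n (value_based ?S) ?f \<le> 1 + ennreal (1 + 2 * real n)"
  proof (rule expected_queries_drift[where \<Phi> = \<Phi>])
    fix t cs xs
    assume run: "(cs, xs) \<in> set_pmf (run n (value_based ?S) ?f t)"
      and miss: "\<forall>x\<in>set xs. \<not> maximizer n ?f x"
    have len: "length xs = Suc t" using run by (rule length_run)
    have cube: "set xs \<subseteq> cube n" using run by (rule run_uniform_strategy(1))
    have zxs: "z \<notin> set xs" using miss maximizer_Om_iff[OF z z] by auto
    show "1 + (\<integral>\<^sup>+x. \<Phi> (xs @ [x]) \<partial>next_point ?S ?f xs) \<le> \<Phi> xs"
    proof (cases t)
      case 0
      then obtain x where x: "xs = [x]" using len by (auto simp: length_Suc_conv)
      have "\<Phi> (xs @ [y]) \<le> ennreal (2 * real n)" if "y \<in> set_pmf (next_point ?S ?f xs)" for y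
        using first_next_point[of x y] pair_init(2)[of y x] that cube x by (simp add: \<Phi>_def)
      hence "(\<integral>\<^sup>+x. \<Phi> (xs @ [x]) \<partial>next_point ?S ?f xs) \<le> (\<integral>\<^sup>+x. ennreal (2 * real n) \<partial>next_point ?S ?f xs)"
        by (intro nn_integral_mono_AE) (auto simp: AE_measure_pmf_iff)
      hence "1 + (\<integral>\<^sup>+x. \<Phi> (xs @ [x]) \<partial>next_point ?S ?f xs) \<le> 1 + ennreal (2 * real n)"
        by (intro add_left_mono) simp
      also have "\<dots> = \<Phi> xs" using x by (simp add: \<Phi>_def)
      finally show ?thesis .
    next
      case (Suc u)
      have inv: "pair_invariant xs" using pair_invariant_run[OF run zxs] Suc by simp
      have len': "length xs = u + 2" using len Suc by simp
      obtain a b where ab: "pair_at (map ?f xs) u = (a, b)" by fastforce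
      let ?A = "wrong (xs ! a)" and ?B = "wrong (xs ! b)" and ?D = "disagree n (xs ! a) (xs ! b)"
      have "a < length xs" using pair_at_less[of "map ?f xs" u] ab len' by auto
      hence "xs ! a \<noteq> z" "xs ! a \<in> cube n" using zxs cube by auto
      hence "?A \<noteq> {}"
        using z disagree_eq_empty_iff[of z n "xs ! a"] unfolding wrong_def by auto
      have disj: "?A \<inter> ?B = {}" and le: "card ?B \<le> card ?A"
        and count: "wrong_count xs = card ?A + card ?B"
        using inv len' ab by (auto simp: pair_invariant_def wrong_count_def wrong_pair_def)
      have D: "?D = ?A \<union> ?B" using disj unfolding disagree_wrong by auto
      hence ne: "?D \<noteq> {}" using \<open>?A \<noteq> {}\<close> by auto
      have card: "card ?D = wrong_count xs"
        using disj by (simp add: D count card_Un_disjoint)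
      define w where "w = real (wrong_count xs)"
      have w: "w > 0" using ne card unfolding w_def by (metis card_gt_0_iff finite_disagree of_nat_0_less_iff)
      have val: "\<Phi> (xs @ [flip n (xs ! a) {j}]) = ennreal (2 * w - 2 * (if j \<in> ?A then 1 else 0))"
        if "j \<in> ?D" for j
      proof -
        have "disagree n (flip n (xs ! a) {j}) (xs ! a) = {j}"
          using that disagree_subset[of n "xs ! a" "xs ! b"] by (auto simp: disagree_flip_left)
        from pair_step_update(2)[OF inv len' ab this that] show ?thesis
          using len' by (simp add: \<Phi>_def w_def)
      qed
      have nonneg: "2 * w - 2 * (if j \<in> ?A then 1 else 0) \<ge> (0::real)" if "j \<in> ?D" for j
        using card that ne by (auto simp: w_def card_gt_0_iff Suc_le_eq simp flip: card)
      have "(\<Sum>j\<in>?D. 2 * w - 2 * (if j \<in> ?A then 1 else 0)) = 2 * w * w - 2 * real (card ?A)"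
      proof -
        have "?D \<inter> {j. j \<in> ?A} = ?A" using D by auto
        thus ?thesis
          by (simp add: sum_subtractf sum_distrib_left[symmetric] sum.If_cases card w_def)
      qed
      hence sum: "(\<Sum>j\<in>?D. ennreal (2 * w - 2 * (if j \<in> ?A then 1 else 0))) = ennreal (2 * w * w - 2 * real (card ?A))"
        using nonneg by (simp add: sum_ennreal)
      have "(\<integral>\<^sup>+x. \<Phi> (xs @ [x]) \<partial>next_point ?S ?f xs)
          = (\<Sum>j\<in>?D. \<Phi> (xs @ [flip n (xs ! a) {j}])) / ennreal w"
        unfolding pair_next_point[OF len' cube ab ne] using ne
        by (simp add: nn_integral_pmf_of_set card w_def ennreal_of_nat_eq_real_of_nat)
      also have "\<dots> = ennreal ((2 * w * w - 2 * real (card ?A)) / w)"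
      proof -
        have "2 * w * w - 2 * real (card ?A) = (\<Sum>j\<in>?D. 2 * w - 2 * (if j \<in> ?A then 1 else 0))"
          using \<open>(\<Sum>j\<in>?D. 2 * w - 2 * (if j \<in> ?A then 1 else 0)) = _\<close> by simp
        also have "\<dots> \<ge> 0" using nonneg by (rule sum_nonneg)
        finally have "2 * w * w - 2 * real (card ?A) \<ge> 0" .
        thus ?thesis using val sum w by (simp add: divide_ennreal)
      qed
      finally have int: "(\<integral>\<^sup>+x. \<Phi> (xs @ [x]) \<partial>next_point ?S ?f xs) = ennreal ((2 * w * w - 2 * real (card ?A)) / w)" .
      \<comment> \<open>The string being flipped is the worse one, so it carries at least half of
        all wrong positions.\<close>
      have half: "2 * real (card ?A) \<ge> w" using le by (simp add: w_def count)
      have pos: "(2 * w * w - 2 * real (card ?A)) / w \<le> 2 * w - 1"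
        using w half by (simp add: field_simps)
      have "w \<ge> 1" using w by (simp add: w_def)
      have "1 + ennreal ((2 * w * w - 2 * real (card ?A)) / w) \<le> 1 + ennreal (2 * w - 1)"
        using pos by (intro add_left_mono ennreal_leI)
      also have "\<dots> = ennreal (2 * w)"
        using \<open>w \<ge> 1\<close> by (simp flip: ennreal_1 ennreal_plus)
      also have "\<dots> = \<Phi> xs" using len' by (simp add: \<Phi>_def w_def)
      finally show ?thesis unfolding int .
    qed
  next
    show "\<Phi> [x] \<le> ennreal (1 + 2 * real n)" for x by (simp add: \<Phi>_def)
  qed
  also have "\<dots> = ennreal (2 * real n + 2)"
    by (simp flip: ennreal_1 ennreal_plus)
  finally show ?thesis .
qed

end

lemma unbiased_complexity_OneMax_linear:
  assumes "2 \<le> k" "2 \<le> n"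
  shows "unbiased_complexity n k (OneMax n) \<le> ennreal (3 * real n)"
proof (rule unbiased_complexity_OneMax_le)
  show "unbiased_blackbox n k (value_based (uniform_strategy n k (pair_step n) pair_inputs))"
    using diff_invariant_pair_step[OF assms(1)] by (rule unbiased_uniform_strategy)
  show "expected_queries n (value_based (uniform_strategy n k (pair_step n) pair_inputs)) (Om n z)
      \<le> ennreal (3 * real n)" if "z \<in> cube n" for z
    \<comment> \<open>From \<open>2 \<le> n\<close> one gets \<open>2 * n + 2 \<le> 3 * n\<close>,
      whence the constant 3.\<close>
    by (rule order_trans[OF expected_queries_pair[OF assms(1) that] ennreal_leI])
       (use assms(2) in simp)
qed

section \<open>Detecting families of sets\<close>

text \<open>The vectors \<open>\<delta>\<close> are the differences of two 0/1 vectors, so the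
  condition says that a 0/1 vector is determined by its product with \<open>Q\<close>. The row of
  ones drives the parity argument below and the later passage from signs to sets.\<close>

definition detecting :: "nat \<Rightarrow> nat \<Rightarrow> (nat \<Rightarrow> nat \<Rightarrow> int) \<Rightarrow> bool" where
  "detecting t m Q \<longleftrightarrow>
     (\<forall>i<t. \<forall>j<m. Q i j = 1 \<or> Q i j = -1) \<and> (\<forall>j<m. Q 0 j = 1) \<and>
     (\<forall>\<delta>::nat \<Rightarrow> int. (\<forall>j<m. \<delta> j \<in> {-1, 0, 1}) \<longrightarrow> (\<forall>i<t. (\<Sum>j<m. Q i j * \<delta> j) = 0) \<longrightarrow>
        (\<forall>j<m. \<delta> j = 0))"

lemma sum_lessThan_plus:
  fixes g :: "nat \<Rightarrow> 'a::comm_monoid_add"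
  shows "(\<Sum>j<a + b. g j) = (\<Sum>j<a. g j) + (\<Sum>j<b. g (a + j))"
  by (induction b) (auto simp: add_ac)

text \<open>
  From a matrix \<open>A\<close> with \<open>T + 1\<close> rows one passes to the block matrix with rows \<open>(A, A, J)\<close> and
  \<open>(A, -A, 2 E - J)\<close>, where \<open>J\<close> is all ones and \<open>E\<close> is the identity below a zero row. For
  \<open>(u, v, w)\<close> in the kernel, the sum of both halves gives \<open>A u + E w = 0\<close>. All entries of \<open>A u\<close> have the
  parity of the sum of \<open>u\<close>, and the first entry is 0, so \<open>w\<close> is even and therefore 0.
\<close>

lemma detecting_double:
  assumes Q: "detecting (Suc T) m Q"
  shows "\<exists>Q'. detecting (2 * Suc T) (2 * m + T) Q'"
proof -
  define Q' :: "nat \<Rightarrow> nat \<Rightarrow> int" where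
    "Q' i j =
       (if i < Suc T
        then if j < m then Q i j else if j < m + m then Q i (j - m) else 1
        else if j < m then Q (i - Suc T) j
        else if j < m + m then - Q (i - Suc T) (j - m)
        else if i - Suc T = Suc (j - (m + m)) then 1 else -1)" for i j
  have pm: "Q i j = 1 \<or> Q i j = -1" if "i < Suc T" "j < m" for i j
    using Q that by (auto simp: detecting_def)
  have one: "Q 0 j = 1" if "j < m" for j
    using Q that by (auto simp: detecting_def)
  have kernel: "\<delta> j = 0" if "\<forall>j<m. \<delta> j \<in> {-1, 0, 1}" "\<forall>i<Suc T. (\<Sum>j<m. Q i j * \<delta> j) = 0" "j < m"
    for \<delta> :: "nat \<Rightarrow> int" and j
    using Q that by (auto simp: detecting_def)
  have "\<delta> j = 0" if d: "\<forall>j<2 * m + T. \<delta> j \<in> {-1, 0, 1}"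
    and z: "\<forall>i<2 * Suc T. (\<Sum>j<2 * m + T. Q' i j * \<delta> j) = 0" and j: "j < 2 * m + T"
    for \<delta> :: "nat \<Rightarrow> int" and j
  proof -
    define v where "v j = \<delta> (m + j)" for j
    define w where "w j = \<delta> (m + m + j)" for j
    define U where "U i = (\<Sum>j<m. Q i j * \<delta> j)" for i
    define V where "V i = (\<Sum>j<m. Q i j * v j)" for i
    define W where "W = (\<Sum>j<T. w j)"
    have split: "(\<Sum>j<2 * m + T. g j) = (\<Sum>j<m. g j) + (\<Sum>j<m. g (m + j)) + (\<Sum>j<T. g (m + m + j))"
      for g :: "nat \<Rightarrow> int"
      unfolding mult_2 sum_lessThan_plus by simp
    have top: "U i + V i + W = 0" if "i < Suc T" for i
    proof -
      have "(\<Sum>j<2 * m + T. Q' i j * \<delta> j) = U i + V i + W"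
        unfolding split U_def V_def W_def using that
        by (intro arg_cong2[where f = "(+)"] sum.cong) (auto simp: Q'_def v_def w_def)
      thus ?thesis using z that by auto
    qed
    have bottom: "U i - V i - W + 2 * (\<Sum>j<T. if i = Suc j then w j else 0) = 0" if "i < Suc T" for i
    proof -
      have "(\<Sum>j<T. (if i = Suc j then 1 else -1) * w j)
          = 2 * (\<Sum>j<T. if i = Suc j then w j else 0) - W"
        unfolding W_def sum_distrib_left sum_subtractf[symmetric] by (intro sum.cong) auto
      moreover have "(\<Sum>j<2 * m + T. Q' (Suc T + i) j * \<delta> j)
          = U i + - V i + (\<Sum>j<T. (if i = Suc j then 1 else -1) * w j)"
        unfolding split U_def V_def sum_negf[symmetric] using that
        by (intro arg_cong2[where f = "(+)"] sum.cong) (auto simp: Q'_def v_def w_def)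
      moreover have "(\<Sum>j<2 * m + T. Q' (Suc T + i) j * \<delta> j) = 0"
        using z that by auto
      ultimately show ?thesis by simp
    qed
    have "U 0 = 0" using top[of 0] bottom[of 0] by simp
    hence even0: "even (\<Sum>j<m. \<delta> j)" using one by (simp add: U_def)
    have even: "even (U i)" if "i < Suc T" for i
    proof -
      have "U i = (\<Sum>j<m. (Q i j - 1) * \<delta> j) + (\<Sum>j<m. \<delta> j)"
        unfolding U_def sum.distrib[symmetric] by (simp add: algebra_simps)
      moreover have "even (\<Sum>j<m. (Q i j - 1) * \<delta> j)"
        using pm[OF that] by (intro dvd_sum) fastforce
      ultimately show ?thesis using even0 by simp
    qed
    have w0: "w l = 0" if "l < T" for l
    proof -
      have "(\<Sum>j<T. if Suc l = Suc j then w j else 0) = w l"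
        using that by simp
      hence "U (Suc l) = - w l" using top[of "Suc l"] bottom[of "Suc l"] that by simp
      hence "even (w l)" using even[of "Suc l"] that by simp
      moreover have "w l \<in> {-1, 0, 1}" using d that by (simp add: w_def)
      ultimately show ?thesis by auto
    qed
    have if0: "(\<Sum>j<T. if i = Suc j then w j else 0) = 0" for i
      using w0 by (intro sum.neutral) auto
    have W0: "W = 0" using w0 by (simp add: W_def)
    have UV: "U i = 0" "V i = 0" if "i < Suc T" for i
      using top[OF that] bottom[OF that] if0[of i] W0 by auto
    have u0: "\<delta> j = 0" if "j < m" for j
      by (rule kernel) (use UV(1) d that in \<open>auto simp: U_def\<close>)
    have v0: "v j = 0" if "j < m" for j
      by (rule kernel) (use UV(2) d that in \<open>auto simp: V_def v_def\<close>)
    show ?thesis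
    proof (cases "j < m + m")
      case True
      thus ?thesis using u0[of j] v0[of "j - m"] by (cases "j < m") (auto simp: v_def)
    next
      case False
      thus ?thesis using w0[of "j - (m + m)"] j by (auto simp: w_def)
    qed
  qed
  moreover have "\<forall>i<2 * Suc T. \<forall>j<2 * m + T. Q' i j = 1 \<or> Q' i j = -1"
  proof (intro allI impI)
    fix i j assume "i < 2 * Suc T" "j < 2 * m + T"
    thus "Q' i j = 1 \<or> Q' i j = -1"
      using pm[of i j] pm[of i "j - m"] pm[of "i - Suc T" j] pm[of "i - Suc T" "j - m"]
      by (auto simp: Q'_def)
  qed
  moreover have "\<forall>j<2 * m + T. Q' 0 j = 1"
    using one by (auto simp: Q'_def)
  ultimately have "detecting (2 * Suc T) (2 * m + T) Q'"
    unfolding detecting_def by blast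
  thus ?thesis by blast
qed

text \<open>Doubling turns \<open>m\<close> columns into \<open>2 * m + 2 ^ r - 1\<close>, starting
  from the 1 by 1 matrix. The closed form solves this recursion and is stated for
  \<open>2 * m\<close> to avoid division.\<close>

lemma detecting_exists: "\<exists>Q m. detecting (2 ^ r) m Q \<and> 2 * m = r * 2 ^ r + 2"
proof (induction r)
  case 0
  have "detecting 1 1 (\<lambda>_ _. 1)" by (auto simp: detecting_def)
  thus ?case by (intro exI[of _ "\<lambda>_ _. 1"] exI[of _ 1]) auto
next
  case (Suc r)
  then obtain Q m where Q: "detecting (2 ^ r) m Q" and m: "2 * m = r * 2 ^ r + 2" by blast
  obtain T where T: "2 ^ r = Suc T"
    by (metis gr0_conv_Suc zero_less_numeral zero_less_power)
  obtain Q' where "detecting (2 * Suc T) (2 * m + T) Q'"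
    using detecting_double Q unfolding T by blast
  moreover have "2 * Suc T = 2 ^ Suc r" unfolding power_Suc T ..
  moreover have "2 * (2 * m + T) = Suc r * 2 ^ Suc r + 2"
    using m T by (simp add: algebra_simps)
  ultimately show ?case by metis
qed

definition detecting_sets :: "nat \<Rightarrow> nat set \<Rightarrow> (nat \<Rightarrow> nat set) \<Rightarrow> bool" where
  "detecting_sets t B S \<longleftrightarrow>
     (\<forall>i<t. S i \<subseteq> B) \<and>
     (\<forall>\<delta>::nat \<Rightarrow> int. (\<forall>j\<in>B. \<delta> j \<in> {-1, 0, 1}) \<longrightarrow> (\<forall>i<t. (\<Sum>j\<in>S i. \<delta> j) = 0) \<longrightarrow>
        (\<forall>j\<in>B. \<delta> j = 0))"

text \<open>
  A row of signs is the all-ones row minus twice the indicator of its negative entries. Replacing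
  the all-ones row by the set of all columns and the other rows by their negative entries
  therefore preserves the kernel.
\<close>

lemma detecting_sets_exists:
  assumes "finite B" "2 * card B \<le> r * 2 ^ r + 2"
  shows "\<exists>S. detecting_sets (2 ^ r) B S"
proof -
  obtain Q m where Q: "detecting (2 ^ r) m Q" and m: "2 * m = r * 2 ^ r + 2"
    using detecting_exists by blast
  obtain g where g: "bij_betw g B {..<card B}"
    using assms(1) bij_betw_iff_card by (metis card_lessThan finite_lessThan)
  have inj: "inj_on g B" and img: "g ` B = {..<card B}" using g by (auto simp: bij_betw_def)
  have le: "card B \<le> m" using assms m by simp
  define S where "S i = (if i = 0 then B else {j\<in>B. Q i (g j) = -1})" for i
  have "\<delta> j = 0" if d: "\<forall>j\<in>B. \<delta> j \<in> {-1, 0, 1}" and z: "\<forall>i<2 ^ r. (\<Sum>j\<in>S i. \<delta> j) = 0" and j: "j \<in> B"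
    for \<delta> :: "nat \<Rightarrow> int" and j
  proof -
    \<comment> \<open>\<open>\<delta>\<close> is transported to an initial segment of the columns
      and extended by 0 to the remaining ones, so discarding columns keeps the detecting
      property.\<close>
    define \<epsilon> where "\<epsilon> l = (if l < card B then \<delta> (inv_into B g l) else 0)" for l
    have eg: "\<epsilon> (g j) = \<delta> j" if "j \<in> B" for j
      using inj img that by (auto simp: \<epsilon>_def)
    have reindex: "(\<Sum>l<m. Q i l * \<epsilon> l) = (\<Sum>j\<in>B. Q i (g j) * \<delta> j)" for i
    proof -
      have "(\<Sum>l<m. Q i l * \<epsilon> l) = (\<Sum>l\<in>g ` B. Q i l * \<epsilon> l)"
        using le by (intro sum.mono_neutral_right) (auto simp: img \<epsilon>_def)
      also have "\<dots> = (\<Sum>j\<in>B. Q i (g j) * \<delta> j)"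
        using eg by (simp add: sum.reindex[OF inj])
      finally show ?thesis .
    qed
    have gm: "g j < m" if "j \<in> B" for j
      using imageI[OF that, of g] le unfolding img by simp
    have zero: "(\<Sum>l<m. Q i l * \<epsilon> l) = 0" if i: "i < 2 ^ r" for i
    proof -
      have B0: "(\<Sum>j\<in>B. \<delta> j) = 0" using z[rule_format, of 0] by (simp add: S_def)
      show ?thesis
      proof (cases "i = 0")
        case True
        have "(\<Sum>j\<in>B. Q i (g j) * \<delta> j) = (\<Sum>j\<in>B. \<delta> j)"
          using Q gm True by (intro sum.cong) (auto simp: detecting_def)
        thus ?thesis using B0 reindex by simp
      next
        case False
        have "(\<Sum>j\<in>B. Q i (g j) * \<delta> j) = (\<Sum>j\<in>B. \<delta> j - 2 * (if j \<in> S i then \<delta> j else 0))"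
          using Q gm False i by (intro sum.cong) (fastforce simp: detecting_def S_def)+
        also have "\<dots> = (\<Sum>j\<in>B. \<delta> j) - 2 * (\<Sum>j\<in>S i. \<delta> j)"
        proof -
          have "(\<Sum>j\<in>B. if j \<in> S i then \<delta> j else 0) = (\<Sum>j\<in>S i. \<delta> j)"
            using assms(1) by (subst sum.inter_restrict[symmetric]) (auto simp: S_def intro!: sum.cong)
          thus ?thesis by (simp add: sum_subtractf sum_distrib_left[symmetric])
        qed
        finally show ?thesis using B0 z i reindex by simp
      qed
    qed
    have "\<forall>l<m. \<epsilon> l \<in> {-1, 0, 1}"
      using d img inv_into_into[of _ g B] by (auto simp: \<epsilon>_def)
    hence "\<epsilon> (g j) = 0"
      using Q zero gm[OF j] unfolding detecting_def by blast
    thus ?thesis using eg[OF j] by simp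
  qed
  moreover have "\<forall>i<2 ^ r. S i \<subseteq> B" by (auto simp: S_def)
  ultimately show ?thesis unfolding detecting_sets_def by blast
qed

text \<open>A vector on the image is pulled back along \<open>\<tau>\<close>; injectivity preserves
  the sums.\<close>

lemma detecting_sets_image:
  assumes "detecting_sets t B S" "inj \<tau>"
  shows "detecting_sets t (\<tau> ` B) (\<lambda>i. \<tau> ` S i)"
proof -
  have "\<delta> (\<tau> j) = 0"
    if "\<forall>j\<in>\<tau> ` B. \<delta> j \<in> {-1, 0, 1}" "\<forall>i<t. (\<Sum>j\<in>\<tau> ` S i. \<delta> j) = 0" "j \<in> B"
    for \<delta> :: "nat \<Rightarrow> int" and j
  proof -
    have "\<forall>i<t. (\<Sum>j\<in>S i. (\<delta> \<circ> \<tau>) j) = 0"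
      using that(2) sum.reindex[OF inj_on_subset[OF assms(2) subset_UNIV], of \<delta>] by simp
    moreover have "\<forall>j\<in>B. (\<delta> \<circ> \<tau>) j \<in> {-1, 0, 1}" using that(1) by auto
    ultimately have "(\<delta> \<circ> \<tau>) j = 0"
      using assms(1) that(3) unfolding detecting_sets_def by blast
    thus ?thesis by simp
  qed
  moreover have "\<forall>i<t. \<tau> ` S i \<subseteq> \<tau> ` B"
    using assms(1) by (auto simp: detecting_sets_def)
  ultimately show ?thesis unfolding detecting_sets_def by blast
qed

section \<open>Blockwise optimization\<close>

text \<open>
  Block \<open>b\<close> is the set where the marker \<open>p\<close> and its successor \<open>p'\<close> differ; it occupies the queries
  \<open>b (t + 2) + 1, \<dots>, (b + 1) (t + 2)\<close>. The first of these is \<open>p'\<close>, then come \<open>t\<close> probes \<open>Q i\<close>, and the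
  last is a string \<open>w\<close> that is optimal on all blocks up to \<open>b\<close>. Index 0 plays the role of the
  initial \<open>p\<close> and \<open>w\<close>.
\<close>

definition advance :: "nat \<Rightarrow> nat \<Rightarrow> bits \<Rightarrow> bits \<Rightarrow> bits \<Rightarrow> bool" where
  "advance n m p0 p y \<longleftrightarrow>
     disagree n p y \<inter> disagree n p0 p = {} \<and>
     card (disagree n p y) = min m (n - card (disagree n p0 p))"

text \<open>
  Asking only that the probes extend to some detecting family keeps the operator invariant under
  permutations of the block.
\<close>

definition probe :: "nat \<Rightarrow> nat \<Rightarrow> bits \<Rightarrow> bits \<Rightarrow> (nat \<Rightarrow> bits) \<Rightarrow> nat \<Rightarrow> bits \<Rightarrow> bool" where
  "probe n t p p' Q i y \<longleftrightarrow>
     (\<exists>S. detecting_sets t (disagree n p p') S \<and>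
        (\<forall>l<i. S l = disagree n p (Q l)) \<and> S i = disagree n p y)"

text \<open>The numbers \<open>c i\<close> are the observed gains of the probes over
  \<open>p\<close>. The string \<open>y\<close> must agree with \<open>w\<close> off the block and
  must itself, if it were the target, produce exactly these gains.\<close>

definition correct :: "nat \<Rightarrow> nat \<Rightarrow> (nat \<Rightarrow> real) \<Rightarrow> bits \<Rightarrow> bits \<Rightarrow> bits \<Rightarrow> (nat \<Rightarrow> bits) \<Rightarrow> bits \<Rightarrow> bool" where
  "correct n t c p p' w Q y \<longleftrightarrow>
     disagree n y w \<subseteq> disagree n p p' \<and>
     (\<forall>i<t. real (card (disagree n y p)) - real (card (disagree n y (Q i))) = c i)"

lemma advance_exists:
  assumes p: "p \<in> cube n"
  shows "\<exists>y\<in>cube n. advance n m p0 p y"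
proof -
  let ?D = "disagree n p0 p"
  have "card ({..<n} - ?D) = n - card ?D"
    using card_Diff_subset[of ?D "{..<n}"] disagree_subset by auto
  hence "min m (n - card ?D) \<le> card ({..<n} - ?D)" by simp
  then obtain T where T: "T \<subseteq> {..<n} - ?D" "card T = min m (n - card ?D)"
    by (rule obtain_subset_with_card_n)
  have "disagree n p (flip n p T) = T"
    using T(1) by (intro disagree_flip) auto
  thus ?thesis
    using T by (intro bexI[of _ "flip n p T"]) (auto simp: advance_def)
qed

lemma advanceD:
  assumes "advance n m p0 p y"
  shows "disagree n p0 y = disagree n p0 p \<union> disagree n p y"
    and "card (disagree n p y) \<le> m"
    and "card (disagree n p0 p) = min n a \<Longrightarrow> card (disagree n p0 y) = min n (a + m)"
proof -
  show un: "disagree n p0 y = disagree n p0 p \<union> disagree n p y"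
    using assms by (auto simp: advance_def disagree_def)
  show "card (disagree n p y) \<le> m" using assms by (simp add: advance_def)
  have "card (disagree n p0 y) = card (disagree n p0 p) + card (disagree n p y)"
    unfolding un using assms by (intro card_Un_disjoint) (auto simp: advance_def)
  thus "card (disagree n p0 y) = min n (a + m)" if "card (disagree n p0 p) = min n a"
    using assms that by (auto simp: advance_def min_def)
qed

text \<open>Induction on the number of probes: a detecting family extending the first
  \<open>i\<close> probes shows that the next predicate is satisfiable, hence satisfied, which again
  provides such a family. After \<open>t\<close> probes the family consists of the probes
  themselves.\<close>

lemma probes_detect:
  assumes det: "\<exists>S. detecting_sets t (disagree n p p') S"
    and probe: "\<And>i y. i < t \<Longrightarrow> y \<in> cube n \<Longrightarrow> probe n t p p' Q i y \<Longrightarrow> probe n t p p' Q i (Q i)"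
  shows "detecting_sets t (disagree n p p') (\<lambda>i. disagree n p (Q i))"
proof -
  have "\<exists>S. detecting_sets t (disagree n p p') S \<and> (\<forall>l<i. S l = disagree n p (Q l))" if "i \<le> t" for i
    using that
  proof (induction i)
    case 0
    show ?case using det by auto
  next
    case (Suc i)
    then obtain S where S: "detecting_sets t (disagree n p p') S" "\<forall>l<i. S l = disagree n p (Q l)"
      by auto
    have "S i \<subseteq> disagree n p p'" using S(1) Suc.prems by (auto simp: detecting_sets_def)
    \<comment> \<open>The witness for the next probe flips \<open>p\<close> exactly on the set
      prescribed by the family.\<close>
    hence "S i = disagree n p (flip n p (S i))"
      using disagree_subset[of n p p'] by (intro disagree_flip[symmetric]) auto
    hence "probe n t p p' Q i (flip n p (S i))"
      using S unfolding probe_def by blast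
    hence "probe n t p p' Q i (Q i)" using probe[of i] Suc.prems by auto
    then obtain S' where "detecting_sets t (disagree n p p') S'"
      "\<forall>l<i. S' l = disagree n p (Q l)" "S' i = disagree n p (Q i)"
      unfolding probe_def by blast
    thus ?case by (auto simp: less_Suc_eq)
  qed
  from this[of t] obtain S
    where S: "detecting_sets t (disagree n p p') S" "\<forall>l<t. S l = disagree n p (Q l)" by blast
  show ?thesis using S(1) unfolding detecting_sets_def by (simp add: S(2))
qed

text \<open>Both \<open>w'\<close> and \<open>z\<close> explain the observed gains. By
  \<open>card_disagree_diff\<close> the indicators of where they differ from \<open>p\<close> have
  equal sums over every probe set, and the detecting property makes them equal on the block.\<close>

lemma correct_solves:
  assumes det: "detecting_sets t (disagree n p p') (\<lambda>i. disagree n p (Q i))"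
    and correct: "\<And>y. y \<in> cube n \<Longrightarrow> correct n t (\<lambda>i. Om n z (Q i) - Om n z p) p p' w Q y \<Longrightarrow>
      correct n t (\<lambda>i. Om n z (Q i) - Om n z p) p p' w Q w'"
  shows "disagree n z w' = disagree n z w - disagree n p p'"
proof -
  let ?B = "disagree n p p'"
  let ?S = "\<lambda>i. disagree n p (Q i)" and ?\<chi> = "\<lambda>y j. if j \<in> disagree n y p then 1 else (0::int)"
  have sub: "?S i \<subseteq> ?B" if "i < t" for i using det that by (auto simp: detecting_sets_def)
  have iff: "correct n t (\<lambda>i. Om n z (Q i) - Om n z p) p p' w Q y \<longleftrightarrow>
      disagree n y w \<subseteq> ?B \<and> (\<forall>i<t. (\<Sum>j\<in>?S i. ?\<chi> y j - ?\<chi> z j) = 0)" for y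
  proof -
    have "real (card (disagree n y p)) - real (card (disagree n y (Q i))) = Om n z (Q i) - Om n z p
        \<longleftrightarrow> (\<Sum>j\<in>?S i. ?\<chi> y j - ?\<chi> z j) = 0" for i
    proof -
      have "real (card (disagree n y p)) - real (card (disagree n y (Q i))) = Om n z (Q i) - Om n z p
        \<longleftrightarrow> int (card (disagree n y p)) - int (card (disagree n y (Q i)))
           = int (card (disagree n z p)) - int (card (disagree n z (Q i)))"
        unfolding Om_eq_disagree by linarith
      also have "\<dots> \<longleftrightarrow> (\<Sum>j\<in>?S i. 2 * ?\<chi> y j - 1) - (\<Sum>j\<in>?S i. 2 * ?\<chi> z j - 1) = 0"
        unfolding card_disagree_diff by simp
      also have "(\<Sum>j\<in>?S i. 2 * ?\<chi> y j - 1) - (\<Sum>j\<in>?S i. 2 * ?\<chi> z j - 1) = 2 * (\<Sum>j\<in>?S i. ?\<chi> y j - ?\<chi> z j)"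
        unfolding sum_subtractf[symmetric] sum_distrib_left by (intro sum.cong) auto
      finally show ?thesis by simp
    qed
    thus ?thesis by (simp add: correct_def)
  qed
  \<comment> \<open>The witness agrees with \<open>z\<close> on the block and with \<open>w\<close>
    elsewhere, so it explains the gains.\<close>
  let ?y = "flip n w (disagree n z w \<inter> ?B)"
  have "disagree n ?y w \<subseteq> ?B"
    by (auto simp: disagree_flip_left)
  moreover have "j \<in> disagree n ?y p \<longleftrightarrow> j \<in> disagree n z p" if "j \<in> ?B" for j
    using that by (auto simp: disagree_flip_left) (auto simp: disagree_def)
  hence "?\<chi> ?y j - ?\<chi> z j = 0" if "i < t" "j \<in> ?S i" for i j
    using sub[OF that(1)] that(2) by auto
  hence "(\<Sum>j\<in>?S i. ?\<chi> ?y j - ?\<chi> z j) = 0" if "i < t" for i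
    using that by (intro sum.neutral) blast
  ultimately have "correct n t (\<lambda>i. Om n z (Q i) - Om n z p) p p' w Q ?y"
    unfolding iff by blast
  hence "correct n t (\<lambda>i. Om n z (Q i) - Om n z p) p p' w Q w'"
    by (rule correct[rotated]) simp
  hence w': "disagree n w' w \<subseteq> ?B" "\<forall>i<t. (\<Sum>j\<in>?S i. ?\<chi> w' j - ?\<chi> z j) = 0"
    unfolding iff by auto
  define \<delta> where "\<delta> j = ?\<chi> w' j - ?\<chi> z j" for j
  have "\<forall>j\<in>?B. \<delta> j \<in> {-1, 0, 1}" by (auto simp: \<delta>_def)
  moreover have "\<forall>i<t. (\<Sum>j\<in>?S i. \<delta> j) = 0" using w'(2) by (simp add: \<delta>_def)
  ultimately have "\<forall>j\<in>?B. \<delta> j = 0"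
    using det unfolding detecting_sets_def by meson
  hence zero: "\<forall>j\<in>?B. ?\<chi> w' j - ?\<chi> z j = 0" by (simp add: \<delta>_def)
  \<comment> \<open>Bits are Boolean, so two strings that both agree or both disagree with
    \<open>p\<close> at \<open>j\<close> coincide there.\<close>
  hence "j \<notin> disagree n z w'" if "j \<in> ?B" for j
    using bspec[OF zero that] that by (auto simp: disagree_def split: if_splits)
  moreover have "j \<in> disagree n z w' \<longleftrightarrow> j \<in> disagree n z w" if "j \<notin> ?B" for j
    using w'(1) that by (auto simp: disagree_def)
  ultimately show ?thesis by blast
qed

section \<open>The block strategy\<close>

definition advance_index :: "nat \<Rightarrow> nat \<Rightarrow> nat" where
  "advance_index t b = (if b = 0 then 0 else (b - 1) * (t + 2) + 1)"

text \<open>The slots hold \<open>x^0\<close>, \<open>p\<close>, \<open>p'\<close>, \<open>w\<close>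
  and then the \<open>t\<close> probes, which is why arity \<open>t + 4\<close> is required. The
  subtraction of 1 leaves out \<open>x^0\<close>, which belongs to no block. Indices of points not
  yet queried are replaced by \<open>pad_indices\<close>.\<close>

definition block_inputs :: "nat \<Rightarrow> real list \<Rightarrow> nat list" where
  "block_inputs t vs =
     (let b = (length vs - 1) div (t + 2) in
        [0, advance_index t b, advance_index t (Suc b), b * (t + 2)] @
        map (\<lambda>i. b * (t + 2) + 2 + i) [0..<t])"

definition block_step :: "nat \<Rightarrow> nat \<Rightarrow> nat \<Rightarrow> real list \<Rightarrow> bits list \<Rightarrow> bits \<Rightarrow> bool" where
  "block_step n m t vs xs y \<longleftrightarrow>
     (let b = (length vs - 1) div (t + 2); r = (length vs - 1) mod (t + 2) in
        if r = 0 then advance n m (xs ! 0) (xs ! 1) y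
        else if r \<le> t then probe n t (xs ! 1) (xs ! 2) (\<lambda>i. xs ! (4 + i)) (r - 1) y
        else correct n t (\<lambda>i. vs ! (b * (t + 2) + 2 + i) - vs ! advance_index t b)
               (xs ! 1) (xs ! 2) (xs ! 3) (\<lambda>i. xs ! (4 + i)) y)"

text \<open>All three predicates are built from disagreement sets, their cardinalities and detecting
  families, which \<open>\<tau>\<close> carries along. Objective values enter only as
  constants.\<close>

lemma diff_invariant_block_step:
  assumes k: "t + 4 \<le> k"
  shows "diff_invariant n k (block_step n m t vs)"
  unfolding diff_invariant_def
proof (intro allI impI)
  fix \<tau> g xs y
  assume \<tau>: "\<tau> permutes {..<n}"
    and g: "\<forall>x\<in>cube n. \<forall>y\<in>cube n. disagree n (g x) (g y) = \<tau> ` disagree n x y"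
    and xs: "length xs = k" "set xs \<subseteq> cube n" "y \<in> cube n" and P: "block_step n m t vs xs y"
  have mem: "xs ! i \<in> cube n" and nth: "map g xs ! i = g (xs ! i)" if "i < t + 4" for i
    using that xs(1) k by (auto intro!: subsetD[OF xs(2)] nth_mem)
  have inj: "inj \<tau>" using \<tau> by (rule permutes_inj)
  hence card: "card (\<tau> ` A) = card A" for A by (meson card_image inj_on_subset subset_UNIV)
  have dis: "disagree n (g (xs ! i)) (g (xs ! j)) = \<tau> ` disagree n (xs ! i) (xs ! j)"
    if "i < t + 4" "j < t + 4" for i j
    using g mem that by auto
  have dis_y: "disagree n (g (xs ! i)) (g y) = \<tau> ` disagree n (xs ! i) y"
    "disagree n (g y) (g (xs ! i)) = \<tau> ` disagree n y (xs ! i)"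
    if "i < t + 4" for i
    using g mem xs(3) that by auto
  have advance: "advance n m (map g xs ! 0) (map g xs ! 1) (g y)" if "advance n m (xs ! 0) (xs ! 1) y"
    using that unfolding advance_def
    by (simp add: nth dis dis_y card image_Int[OF inj, symmetric])
  have probe: "probe n t (map g xs ! 1) (map g xs ! 2) (\<lambda>i. map g xs ! (4 + i)) r (g y)"
    if r: "r < t" and p: "probe n t (xs ! 1) (xs ! 2) (\<lambda>i. xs ! (4 + i)) r y" for r
  proof -
    obtain S where "detecting_sets t (disagree n (xs ! 1) (xs ! 2)) S"
      "\<forall>l<r. S l = disagree n (xs ! 1) (xs ! (4 + l))" "S r = disagree n (xs ! 1) y"
      using p unfolding probe_def by blast
    thus ?thesis
      unfolding probe_def using detecting_sets_image[OF _ inj] r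
      by (intro exI[of _ "\<lambda>i. \<tau> ` S i"]) (simp add: nth dis dis_y)
  qed
  have correct: "correct n t c (map g xs ! 1) (map g xs ! 2) (map g xs ! 3) (\<lambda>i. map g xs ! (4 + i)) (g y)"
    if "correct n t c (xs ! 1) (xs ! 2) (xs ! 3) (\<lambda>i. xs ! (4 + i)) y" for c
    using that inj unfolding correct_def
    by (simp add: nth dis dis_y card inj_image_subset_iff)
  show "block_step n m t vs (map g xs) (g y)"
    using P advance probe correct unfolding block_step_def Let_def by (auto split: if_splits)
qed

text \<open>The claim holds for every run in the support: all predicates met along the way are
  satisfiable, so the random choices only permute positions without affecting success.\<close>

lemma block_strategy_solves:
  assumes k: "t + 4 \<le> k" and z: "z \<in> cube n" and q: "n \<le> q * m"
    and det: "\<And>B. finite B \<Longrightarrow> card B \<le> m \<Longrightarrow> \<exists>S. detecting_sets t B S"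
    and run: "(cs, xs) \<in> set_pmf (run n (value_based (uniform_strategy n k (block_step n m t) (block_inputs t)))
      (Om n z) (q * (t + 2)))"
  shows "xs ! (q * (t + 2)) = z"
proof -
  define s where "s = t + 2"
  let ?f = "Om n z" and ?in = "\<lambda>u. op_inputs k (block_inputs t) (Om n z) (take u xs)"
  let ?p = "\<lambda>b. xs ! advance_index t b" and ?w = "\<lambda>b. xs ! (b * s)" and ?Q = "\<lambda>b i. xs ! (b * s + 2 + i)"
  have len: "length xs = Suc (q * s)" using length_run[OF run] by (simp add: s_def)
  have cube: "xs ! u \<in> cube n" if "u \<le> q * s" for u
    using subsetD[OF run_uniform_strategy(1)[OF run]] nth_mem[of u xs] that len by simp
  note follow = run_uniform_strategy(2)[OF run]
  have s_pos: "s > 0" by (simp add: s_def)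
  have adv_Suc: "advance_index t (Suc b) = b * s + 1" for b
    by (simp add: advance_index_def s_def)
  have adv_le: "advance_index t b \<le> b * s" for b
    by (cases b) (auto simp: advance_index_def s_def)
  have next_le: "b * s + s \<le> q * s" if "b < q" for b
    using mult_le_mono1[of "Suc b" q s] that by simp
  \<comment> \<open>Here \<open>r\<close> is the phase within block \<open>b\<close>. Slot 2 is
    meaningful once \<open>p'\<close> exists, and slot \<open>4 + i\<close> once probe
    \<open>i\<close> has been queried; before that they hold padding.\<close>
  have inputs: "?in (b * s + 1 + r) ! 0 = xs ! 0" "?in (b * s + 1 + r) ! 1 = ?p b"
      "?in (b * s + 1 + r) ! 3 = ?w b"
      "r > 0 \<Longrightarrow> ?in (b * s + 1 + r) ! 2 = ?p (Suc b)"
      "\<And>i. i < t \<Longrightarrow> i + 1 < r \<Longrightarrow> ?in (b * s + 1 + r) ! (4 + i) = ?Q b i"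
    if "b < q" "r < s" for b r
  proof -
    have lt: "b * s + 1 + r \<le> q * s" using next_le[OF that(1)] that(2) by simp
    have L: "length (take (b * s + 1 + r) xs) = b * s + 1 + r" using lt len by simp
    have J: "block_inputs t (map ?f (take (b * s + 1 + r) xs))
        = [0, advance_index t b, advance_index t (Suc b), b * s] @ map (\<lambda>i. b * s + 2 + i) [0..<t]"
    proof -
      have "(b * s + r) div s = b" using that(2) s_pos by simp
      moreover have "length (map ?f (take (b * s + 1 + r) xs)) - 1 = b * s + r" using L by simp
      ultimately show ?thesis by (simp only: block_inputs_def Let_def s_def[symmetric])
    qed
    have nth: "?in (b * s + 1 + r) ! i = xs ! j"
      if "i < t + 4" "([0, advance_index t b, advance_index t (Suc b), b * s] @ map (\<lambda>i. b * s + 2 + i) [0..<t]) ! i = j"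
        "j \<le> b * s + r" for i j
    proof -
      have "?in (b * s + 1 + r) ! i
          = take (b * s + 1 + r) xs ! (block_inputs t (map ?f (take (b * s + 1 + r) xs)) ! i)"
      proof (rule op_inputs_nth)
        show "i < k" using that(1) k by simp
        show "i < length (block_inputs t (map ?f (take (b * s + 1 + r) xs)))"
          unfolding J using that(1) by simp
        show "block_inputs t (map ?f (take (b * s + 1 + r) xs)) ! i < length (take (b * s + 1 + r) xs)"
          unfolding J that(2) L using that(3) by simp
      qed
      thus ?thesis unfolding J that(2) using that(3) by simp
    qed
    show "?in (b * s + 1 + r) ! 0 = xs ! 0" by (rule nth) auto
    show "?in (b * s + 1 + r) ! 1 = ?p b" by (rule nth) (use adv_le[of b] in auto)
    show "?in (b * s + 1 + r) ! 3 = ?w b" by (rule nth) auto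
    show "?in (b * s + 1 + r) ! 2 = ?p (Suc b)" if "r > 0"
      by (rule nth) (use that adv_Suc in auto)
    show "?in (b * s + 1 + r) ! (4 + i) = ?Q b i" if "i < t" "i + 1 < r" for i
      by (rule nth) (use that in \<open>auto simp: nth_append\<close>)
  qed
  have step: "block_step n m t (map ?f (take (b * s + 1 + r) xs)) xs' y \<longleftrightarrow>
      (if r = 0 then advance n m (xs' ! 0) (xs' ! 1) y
       else if r \<le> t then probe n t (xs' ! 1) (xs' ! 2) (\<lambda>i. xs' ! (4 + i)) (r - 1) y
       else correct n t (\<lambda>i. map ?f (take (b * s + 1 + r) xs) ! (b * s + 2 + i)
               - map ?f (take (b * s + 1 + r) xs) ! advance_index t b)
              (xs' ! 1) (xs' ! 2) (xs' ! 3) (\<lambda>i. xs' ! (4 + i)) y)"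
    if "b < q" "r < s" for b r xs' y
  proof -
    have lt: "b * s + 1 + r \<le> q * s" using next_le[OF that(1)] that(2) by simp
    have "(b * s + r) div s = b" "(b * s + r) mod s = r" using that(2) s_pos by simp_all
    moreover have "length (map ?f (take (b * s + 1 + r) xs)) - 1 = b * s + r" using lt len by simp
    ultimately show ?thesis by (simp only: block_step_def Let_def s_def[symmetric])
  qed
  have advance: "advance n m (xs ! 0) (?p b) (?p (Suc b))" if b: "b < q" for b
  proof -
    have s0: "0 < s" by (simp add: s_def)
    have le: "b * s + 1 + 0 \<le> q * (t + 2)" using next_le[OF b] by (simp add: s_def)
    have "?p b \<in> cube n" using adv_le[of b] next_le[OF b] by (intro cube) simp
    then obtain y where y: "y \<in> cube n" "advance n m (xs ! 0) (?p b) y"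
      using advance_exists by blast
    from follow[OF _ le y(1)] y(2) show ?thesis
      unfolding step[OF b s0] using inputs(1,2)[OF b s0] adv_Suc[of b] by simp
  qed
  have probe: "probe n t (?p b) (?p (Suc b)) (?Q b) i (?Q b i)"
    if b: "b < q" and i: "i < t" and y: "y \<in> cube n" "probe n t (?p b) (?p (Suc b)) (?Q b) i y" for b i y
  proof -
    have r: "i + 1 < s" and pos: "0 < i + 1" using i by (simp_all add: s_def)
    have le: "b * s + 1 + (i + 1) \<le> q * (t + 2)" using next_le[OF b] i by (simp add: s_def)
    have "?in (b * s + 1 + (i + 1)) ! (4 + l) = ?Q b l" if "l < i" for l
      using that i by (intro inputs(5)[OF b r]) auto
    \<comment> \<open>Only earlier probes occur in \<open>probe\<close>, so the padded slots of
      later ones do not matter.\<close>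
    hence eq: "probe n t (?in (b * s + 1 + (i + 1)) ! 1) (?in (b * s + 1 + (i + 1)) ! 2)
        (\<lambda>l. ?in (b * s + 1 + (i + 1)) ! (4 + l)) i y' \<longleftrightarrow> probe n t (?p b) (?p (Suc b)) (?Q b) i y'" for y'
      unfolding probe_def inputs(2)[OF b r] inputs(4)[OF b r pos]
      by (simp cong: conj_cong)
    have iff: "block_step n m t (map ?f (take (b * s + 1 + (i + 1)) xs)) (?in (b * s + 1 + (i + 1))) y' \<longleftrightarrow>
        probe n t (?p b) (?p (Suc b)) (?Q b) i y'" for y'
      unfolding step[OF b r] eq[symmetric] using i by simp
    from follow[OF _ le y(1)] y(2) show ?thesis unfolding iff by (simp add: add_ac)
  qed
  have correct: "correct n t (\<lambda>i. ?f (?Q b i) - ?f (?p b)) (?p b) (?p (Suc b)) (?w b) (?Q b) (?w (Suc b))"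
    if b: "b < q" and y: "y \<in> cube n"
      "correct n t (\<lambda>i. ?f (?Q b i) - ?f (?p b)) (?p b) (?p (Suc b)) (?w b) (?Q b) y" for b y
  proof -
    have r: "t + 1 < s" and pos: "0 < t + 1" by (simp_all add: s_def)
    have le: "b * s + 1 + (t + 1) \<le> q * (t + 2)" using next_le[OF b] by (simp add: s_def)
    have val: "map ?f (take (b * s + 1 + (t + 1)) xs) ! j = ?f (xs ! j)" if "j \<le> b * s + t + 1" for j
      using that le len by (simp add: s_def)
    have iff: "block_step n m t (map ?f (take (b * s + 1 + (t + 1)) xs)) (?in (b * s + 1 + (t + 1))) y' \<longleftrightarrow>
        correct n t (\<lambda>i. ?f (?Q b i) - ?f (?p b)) (?p b) (?p (Suc b)) (?w b) (?Q b) y'" for y'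
    proof -
      have "?in (b * s + 1 + (t + 1)) ! (4 + l) = ?Q b l" if "l < t" for l
        using that by (intro inputs(5)[OF b r]) auto
      moreover have "map ?f (take (b * s + 1 + (t + 1)) xs) ! (b * s + 2 + l) = ?f (?Q b l)" if "l < t" for l
        using that by (intro val) simp
      moreover have "map ?f (take (b * s + 1 + (t + 1)) xs) ! advance_index t b = ?f (?p b)"
        using adv_le[of b] by (intro val) simp
      moreover have "\<not> t + 1 \<le> t" "t + 1 \<noteq> 0" by simp_all
      ultimately show ?thesis
        unfolding step[OF b r] correct_def inputs(2,3)[OF b r] inputs(4)[OF b r pos]
        by (simp only: if_False cong: conj_cong) auto
    qed
    from follow[OF _ le y(1)] y(2) show ?thesis unfolding iff by (simp add: s_def add_ac)
  qed
  \<comment> \<open>Invariant after \<open>b\<close> blocks: the marked positions number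
    \<open>min n (b * m)\<close>, and \<open>?w b\<close> is correct on all of them. At
    \<open>b = q\<close> every position is marked.\<close>
  have "card (disagree n (xs ! 0) (?p b)) = min n (b * m) \<and> disagree n z (?w b) \<inter> disagree n (xs ! 0) (?p b) = {}"
    if "b \<le> q" for b
    using that
  proof (induction b)
    case 0
    show ?case by (simp add: advance_index_def)
  next
    case (Suc b)
    hence b: "b < q" by simp
    note adv = advanceD[OF advance[OF b]]
    have "\<exists>S. detecting_sets t (disagree n (?p b) (?p (Suc b))) S"
      using adv(2) by (intro det) auto
    hence "detecting_sets t (disagree n (?p b) (?p (Suc b))) (\<lambda>i. disagree n (?p b) (?Q b i))"
      using probe[OF b] by (rule probes_detect)
    hence "disagree n z (?w (Suc b)) = disagree n z (?w b) - disagree n (?p b) (?p (Suc b))"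
      using correct[OF b] by (rule correct_solves)
    moreover have "card (disagree n (xs ! 0) (?p (Suc b))) = min n (Suc b * m)"
      using adv(3)[of "b * m"] Suc by (simp add: add.commute)
    ultimately show ?case using Suc b adv(1) by auto
  qed
  from this[of q] have card: "card (disagree n (xs ! 0) (?p q)) = n"
    and dis: "disagree n z (?w q) \<inter> disagree n (xs ! 0) (?p q) = {}"
    using q by auto
  have "disagree n (xs ! 0) (?p q) = {..<n}"
    using card disagree_subset by (metis card_lessThan card_subset_eq finite_lessThan)
  hence "disagree n z (?w q) = {}" using dis disagree_subset by blast
  thus ?thesis
    using disagree_eq_empty_iff[OF z cube[of "q * s"]] by (simp add: s_def)
qed

section \<open>Query bounds from the block parameters, and asymptotics in the arity\<close>

lemma unbiased_complexity_OneMax_blocks: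
  assumes k: "t + 4 \<le> k" and q: "n \<le> q * m"
    and det: "\<And>B. finite B \<Longrightarrow> card B \<le> m \<Longrightarrow> \<exists>S. detecting_sets t B S"
  shows "unbiased_complexity n k (OneMax n) \<le> of_nat (q * (t + 2) + 1)"
proof (rule unbiased_complexity_OneMax_le)
  let ?A = "value_based (uniform_strategy n k (block_step n m t) (block_inputs t))"
  show "unbiased_blackbox n k ?A"
    using diff_invariant_block_step[OF k] by (rule unbiased_uniform_strategy)
  show "expected_queries n ?A (Om n z) \<le> of_nat (q * (t + 2) + 1)" if z: "z \<in> cube n" for z
  proof (rule expected_queries_bounded_time)
    fix cs xs assume run: "(cs, xs) \<in> set_pmf (run n ?A (Om n z) (q * (t + 2)))"
    have "xs ! (q * (t + 2)) = z" by (rule block_strategy_solves[OF k z q _ run]) (rule det)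
    thus "\<exists>s\<le>q * (t + 2). maximizer n (Om n z) (xs ! s)"
      using maximizer_Om_iff[OF z z] by auto
  qed
qed

text \<open>Blocks of size \<open>m = r * 2 ^ r / 2\<close> cost \<open>2 ^ r + 2\<close> queries
  each. Rounding the number of blocks up adds at most one block, and the query of \<open>x^0\<close>
  gives the final 1.\<close>

lemma unbiased_complexity_OneMax_le_blocks:
  assumes r: "1 \<le> r" and k: "2 ^ r + 4 \<le> k"
  shows "unbiased_complexity n k (OneMax n)
    \<le> ennreal (2 * real n * ((1 + 2 / 2 ^ r) / real r) + 2 ^ r + 3)"
proof -
  obtain r' where r': "r = Suc r'" using r by (cases r) auto
  define m where "m = r * 2 ^ r'"
  have m: "2 * m = r * 2 ^ r" "0 < m" by (simp_all add: m_def r')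
  define q where "q = n div m + 1"
  have q: "n \<le> q * m"
    using dividend_less_div_times[OF m(2), of n] by (simp add: q_def)
  have "\<exists>S. detecting_sets (2 ^ r) B S" if "finite B" "card B \<le> m" for B
    using detecting_sets_exists[OF that(1), of r] that(2) m(1) by simp
  hence "unbiased_complexity n k (OneMax n) \<le> of_nat (q * (2 ^ r + 2) + 1)"
    using k q by (intro unbiased_complexity_OneMax_blocks) auto
  also have "\<dots> = ennreal (real q * (2 ^ r + 2) + 1)"
  proof -
    have "real (q * (2 ^ r + 2) + 1) = real q * (2 ^ r + 2) + 1"
      by (simp add: distrib_left)
    thus ?thesis by (metis ennreal_of_nat_eq_real_of_nat)
  qed
  also have "\<dots> \<le> ennreal (2 * real n * ((1 + 2 / 2 ^ r) / real r) + 2 ^ r + 3)"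
  proof (rule ennreal_leI)
    have m_eq: "real m = real r * 2 ^ r / 2"
      using arg_cong[OF m(1), of real] by simp
    have "real q \<le> real n / real m + 1" by (simp add: q_def of_nat_div_le_of_nat)
    hence "real q * (2 ^ r + 2) \<le> (real n / real m + 1) * (2 ^ r + 2)"
      by (intro mult_right_mono) auto
    also have "\<dots> = 2 * real n * ((1 + 2 / 2 ^ r) / real r) + 2 ^ r + 2"
      unfolding m_eq using r by (simp add: field_simps)
    finally show "real q * (2 ^ r + 2) + 1 \<le> 2 * real n * ((1 + 2 / 2 ^ r) / real r) + 2 ^ r + 3"
      by simp
  qed
  finally show ?thesis .
qed

text \<open>Subtracting the square root keeps the exponent asymptotic to \<open>log 2 k\<close>
  while making \<open>2 powr exponent k\<close> equal to \<open>k / 2 powr sqrt (log 2 k)\<close>,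
  which is o(k / log k). One surplus block is then negligible even for \<open>n = k\<close>.\<close>

definition exponent :: "nat \<Rightarrow> real" where
  "exponent k = log 2 k - sqrt (log 2 k)"

text \<open>The first summand bounds the cost per position after rounding the exponent down by at
  most 1. The second spreads the additive cost of the surplus block over \<open>n \<ge> k\<close>
  positions.\<close>

definition overhead :: "nat \<Rightarrow> real" where
  "overhead k =
     log 2 k * ((1 + 2 / 2 powr (exponent k - 1)) / (exponent k - 1) + (2 powr exponent k + 4) / (2 * k)) - 1"

lemma overhead_tendsto_0: "overhead \<longlonglongrightarrow> 0"
  unfolding overhead_def exponent_def by real_asymp

lemma unbiased_complexity_OneMax_large_arity:
  assumes exponent: "exponent k > 2" "2 powr exponent k + 4 \<le> k" and k: "2 \<le> k" "k \<le> n"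
  shows "unbiased_complexity n k (OneMax n) \<le> ennreal ((1 + overhead k) * (2 * real n / log 2 k))"
proof -
  define \<rho> where "\<rho> = exponent k"
  define r where "r = nat \<lfloor>\<rho>\<rfloor>"
  have \<rho>: "\<rho> > 2" "2 powr \<rho> + 4 \<le> k" using exponent by (simp_all add: \<rho>_def)
  have r: "\<rho> - 1 \<le> real r" "real r \<le> \<rho>" "1 \<le> r"
    using \<rho>(1) by (auto simp: r_def) linarith+
  have pow: "(2::real) ^ r = 2 powr real r" by (simp add: powr_realpow)
  have upper: "(2::real) ^ r \<le> 2 powr \<rho>" and lower: "2 powr (\<rho> - 1) \<le> (2::real) ^ r"
    unfolding pow using r by (auto intro!: powr_mono)
  have "real (2 ^ r + 4) \<le> real k" using upper \<rho>(2) by simp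
  hence "2 ^ r + 4 \<le> k" by (simp only: of_nat_le_iff)
  with r(3) have "unbiased_complexity n k (OneMax n)
      \<le> ennreal (2 * real n * ((1 + 2 / 2 ^ r) / real r) + 2 ^ r + 3)"
    by (rule unbiased_complexity_OneMax_le_blocks)
  also have "\<dots> \<le> ennreal ((1 + overhead k) * (2 * real n / log 2 k))"
  proof (rule ennreal_leI)
    have "(1 + 2 / 2 ^ r) / real r \<le> (1 + 2 / 2 powr (\<rho> - 1)) / (\<rho> - 1)"
      using \<rho>(1) r(1) lower by (intro frac_le add_left_mono divide_left_mono) auto
    hence main: "2 * real n * ((1 + 2 / 2 ^ r) / real r) \<le> 2 * real n * ((1 + 2 / 2 powr (\<rho> - 1)) / (\<rho> - 1))"
      by (intro mult_left_mono) auto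
    \<comment> \<open>The hypothesis \<open>k \<le> n\<close> turns the additive term into a
      multiple of \<open>n\<close>.\<close>
    have "1 \<le> real n / real k" using k by simp
    hence "(2 powr \<rho> + 4) * 1 \<le> (2 powr \<rho> + 4) * (real n / real k)"
      by (intro mult_left_mono) auto
    hence rest: "2 ^ r + 3 \<le> 2 * real n * ((2 powr \<rho> + 4) / (2 * k))"
      using upper by (simp add: mult.commute)
    have "log 2 k > 0" using k by simp
    hence "(1 + overhead k) * (2 * real n / log 2 k)
        = 2 * real n * ((1 + 2 / 2 powr (\<rho> - 1)) / (\<rho> - 1) + (2 powr \<rho> + 4) / (2 * k))"
      by (simp add: overhead_def \<rho>_def)
    thus "2 * real n * ((1 + 2 / 2 ^ r) / real r) + 2 ^ r + 3 \<le> (1 + overhead k) * (2 * real n / log 2 k)"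
      using main rest unfolding distrib_left by linarith
  qed
  finally show ?thesis .
qed

theorem theorem9:
  shows "(\<exists>C::real. \<forall>n k::nat. 2 \<le> k \<and> k \<le> n \<longrightarrow>
            unbiased_complexity n k (OneMax n) \<le> ennreal (C * real n))
       \<and> (\<exists>h::nat \<Rightarrow> real. h \<longlonglongrightarrow> 0 \<and>
            (\<forall>n k::nat. 2 \<le> k \<and> k \<le> n \<longrightarrow>
               unbiased_complexity n k (OneMax n)
                 \<le> ennreal ((1 + h k) * (2 * real n / log 2 (real k)))))"
proof
  show "\<exists>C::real. \<forall>n k::nat. 2 \<le> k \<and> k \<le> n \<longrightarrow>
      unbiased_complexity n k (OneMax n) \<le> ennreal (C * real n)"
    using unbiased_complexity_OneMax_linear by (intro exI[of _ 3]) auto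
  have "eventually (\<lambda>k::nat. exponent k > 2 \<and> 2 powr exponent k + 4 \<le> real k) sequentially"
    unfolding exponent_def by (intro eventually_conj) real_asymp+
  then obtain K where K: "\<And>k. K \<le> k \<Longrightarrow> exponent k > 2 \<and> 2 powr exponent k + 4 \<le> real k"
    unfolding eventually_sequentially by blast
  \<comment> \<open>Below the threshold \<open>K\<close> the value is chosen so that the bound
    becomes exactly \<open>3 * n\<close>, the linear bound. Finitely many values do not affect the
    limit.\<close>
  define h where "h k = (if k < K then 3 / 2 * log 2 k - 1 else overhead k)" for k :: nat
  have "h \<longlonglongrightarrow> 0"
  proof (rule Lim_transform_eventually[OF overhead_tendsto_0])
    show "eventually (\<lambda>k. overhead k = h k) sequentially"
      using eventually_ge_at_top[of K] by eventually_elim (simp add: h_def)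
  qed
  moreover have "unbiased_complexity n k (OneMax n) \<le> ennreal ((1 + h k) * (2 * real n / log 2 (real k)))"
    if k: "2 \<le> k" "k \<le> n" for n k
  proof (cases "k < K")
    case True
    have "log 2 k > 0" using k by simp
    hence "(1 + h k) * (2 * real n / log 2 (real k)) = 3 * real n"
      using True by (simp add: h_def)
    thus ?thesis using unbiased_complexity_OneMax_linear[of k n] k by simp
  next
    case False
    thus ?thesis
      using K[of k] k unbiased_complexity_OneMax_large_arity[of k n] by (simp add: h_def)
  qed
  ultimately show "\<exists>h::nat \<Rightarrow> real. h \<longlonglongrightarrow> 0 \<and>
      (\<forall>n k::nat. 2 \<le> k \<and> k \<le> n \<longrightarrow>
         unbiased_complexity n k (OneMax n) \<le> ennreal ((1 + h k) * (2 * real n / log 2 (real k))))"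
    by blast
qed

end
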